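(* For disjunctive finitely recursive programs $P$ and ground formulas $F$, the problem of deciding whether $F$ is a skeptical consequence of $P$ is semidecidable: there is a procedure which, given such $P$ and $F$, halts with a positive answer if and only if $F$ is a skeptical consequence of $P$.
   Context: A disjunctive program is a finite set of rules $A_1\vee\dots\vee A_m\leftarrow L_1,\dots,L_n$ ($m>0$, $n\ge0$), $A_j$ atoms, $L_i$ atoms or negated atoms $\mathtt{not}\,A$, possibly with function symbols; $head(r)=\{A_1,\dots,A_m\}$. $\mathsf{Ground}(P)$ is its ground instantiation. For a set $M$ of ground atoms, $P^M$ is obtained from $\mathsf{Ground}(P)$ by deleting rules having some $\mathtt{not}\,B$ in the body with $B\in M$ and deleting negative literals from the remaining rules; $M$ is a stable model iff it is a minimal Herbrand model of $P^M$. A ground formula is a closed propositional combination of ground atoms of the language of $P$; it is a skeptical consequence of $P$ iff it is true in every stable model of $P$. The dependency graph has ground atoms as vertices and an edge $A\to B$ whenever some $r\in\mathsf{Ground}(P)$ has $A\in head(r)$ and $B$ occurring in $r$ (body or head); $A$ depends on $B$ if there is a directed path from $A$ to $B$ (every atom depends on itself). $P$ is finitely recursive iff each ground atom depends on finitely many ground atoms. *)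

theory Defs
  imports Main "HOL-Library.Nat_Bijection"
begin

datatype trm = Var nat | Fn nat "trm list"
  \<comment> \<open>function symbols are identified by (name, arity); constants are Fn c []\<close>

datatype atm = Atom nat "trm list"   \<comment> \<open>predicate symbol (name, arity)\<close>

datatype lit = Pos atm | Neg atm

datatype rule = Rule (head: "atm list") (body: "lit list")
  \<comment> \<open>A1 v ... v Am <- L1, ..., Ln\<close>

type_synonym program = "rule list"   \<comment> \<open>a finite set of rules\<close>

definition wf_program :: "program \<Rightarrow> bool" where
  "wf_program P \<longleftrightarrow> (\<forall>r\<in>set P. head r \<noteq> [])"

fun lit_atm :: "lit \<Rightarrow> atm" where
  "lit_atm (Pos a) = a" | "lit_atm (Neg a) = a"

definition rule_atms :: "rule \<Rightarrow> atm set" where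
  "rule_atms r = set (head r) \<union> lit_atm ` set (body r)"

definition prog_atms :: "program \<Rightarrow> atm set" where
  "prog_atms P = (\<Union>r\<in>set P. rule_atms r)"

fun fsyms_trm :: "trm \<Rightarrow> (nat \<times> nat) set" where
  "fsyms_trm (Var v) = {}"
| "fsyms_trm (Fn f ts) = insert (f, length ts) (\<Union>t\<in>set ts. fsyms_trm t)"

fun fsyms_atm :: "atm \<Rightarrow> (nat \<times> nat) set" where
  "fsyms_atm (Atom p ts) = (\<Union>t\<in>set ts. fsyms_trm t)"

fun psym :: "atm \<Rightarrow> nat \<times> nat" where
  "psym (Atom p ts) = (p, length ts)"

fun args :: "atm \<Rightarrow> trm list" where
  "args (Atom p ts) = ts"

text \<open>Function symbols of the language of P; if P has no constant,
  a constant (symbol 0 of arity 0) is added, as usual for Herbrand universes.\<close>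
definition fsyms :: "program \<Rightarrow> (nat \<times> nat) set" where
  "fsyms P = (let S = (\<Union>a\<in>prog_atms P. fsyms_atm a) in
     if (\<exists>c. (c, 0) \<in> S) then S else insert (0, 0) S)"

definition psyms :: "program \<Rightarrow> (nat \<times> nat) set" where
  "psyms P = psym ` prog_atms P"

inductive_set HU :: "program \<Rightarrow> trm set" for P where
  "(f, length ts) \<in> fsyms P \<Longrightarrow> (\<forall>t\<in>set ts. t \<in> HU P) \<Longrightarrow> Fn f ts \<in> HU P"

definition HB :: "program \<Rightarrow> atm set" where
  "HB P = {a. psym a \<in> psyms P \<and> (\<forall>t\<in>set (args a). t \<in> HU P)}"

fun subst_trm :: "(nat \<Rightarrow> trm) \<Rightarrow> trm \<Rightarrow> trm" where
  "subst_trm \<sigma> (Var v) = \<sigma> v"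
| "subst_trm \<sigma> (Fn f ts) = Fn f (map (subst_trm \<sigma>) ts)"

fun subst_atm :: "(nat \<Rightarrow> trm) \<Rightarrow> atm \<Rightarrow> atm" where
  "subst_atm \<sigma> (Atom p ts) = Atom p (map (subst_trm \<sigma>) ts)"

fun subst_lit :: "(nat \<Rightarrow> trm) \<Rightarrow> lit \<Rightarrow> lit" where
  "subst_lit \<sigma> (Pos a) = Pos (subst_atm \<sigma> a)"
| "subst_lit \<sigma> (Neg a) = Neg (subst_atm \<sigma> a)"

fun subst_rule :: "(nat \<Rightarrow> trm) \<Rightarrow> rule \<Rightarrow> rule" where
  "subst_rule \<sigma> (Rule hs bs) = Rule (map (subst_atm \<sigma>) hs) (map (subst_lit \<sigma>) bs)"

definition Ground :: "program \<Rightarrow> rule set" where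
  "Ground P = {subst_rule \<sigma> r | r \<sigma>. r \<in> set P \<and> (\<forall>v. \<sigma> v \<in> HU P)}"

definition pos_body :: "rule \<Rightarrow> atm set" where
  "pos_body r = {a. Pos a \<in> set (body r)}"

definition neg_body :: "rule \<Rightarrow> atm set" where
  "neg_body r = {a. Neg a \<in> set (body r)}"

definition reduct :: "program \<Rightarrow> atm set \<Rightarrow> (atm set \<times> atm set) set" where
  "reduct P M = {(set (head r), pos_body r) | r. r \<in> Ground P \<and> neg_body r \<inter> M = {}}"

definition is_model :: "(atm set \<times> atm set) set \<Rightarrow> atm set \<Rightarrow> bool" where
  "is_model Q N \<longleftrightarrow> (\<forall>(H, B)\<in>Q. B \<subseteq> N \<longrightarrow> H \<inter> N \<noteq> {})"

definition minimal_herbrand_model :: "program \<Rightarrow> (atm set \<times> atm set) set \<Rightarrow> atm set \<Rightarrow> bool" where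
  "minimal_herbrand_model P Q N \<longleftrightarrow> N \<subseteq> HB P \<and> is_model Q N \<and>
     (\<forall>N'. N' \<subset> N \<longrightarrow> \<not> is_model Q N')"

definition stable_model :: "program \<Rightarrow> atm set \<Rightarrow> bool" where
  "stable_model P M \<longleftrightarrow> minimal_herbrand_model P (reduct P M) M"

datatype fm = FAtom atm | FNot fm | FAnd fm fm | FOr fm fm | FImp fm fm

fun fm_atms :: "fm \<Rightarrow> atm set" where
  "fm_atms (FAtom a) = {a}"
| "fm_atms (FNot f) = fm_atms f"
| "fm_atms (FAnd f g) = fm_atms f \<union> fm_atms g"
| "fm_atms (FOr f g) = fm_atms f \<union> fm_atms g"
| "fm_atms (FImp f g) = fm_atms f \<union> fm_atms g"

definition ground_formula :: "program \<Rightarrow> fm \<Rightarrow> bool" where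
  "ground_formula P F \<longleftrightarrow> fm_atms F \<subseteq> HB P"

fun holds :: "atm set \<Rightarrow> fm \<Rightarrow> bool" where
  "holds M (FAtom a) = (a \<in> M)"
| "holds M (FNot f) = (\<not> holds M f)"
| "holds M (FAnd f g) = (holds M f \<and> holds M g)"
| "holds M (FOr f g) = (holds M f \<or> holds M g)"
| "holds M (FImp f g) = (holds M f \<longrightarrow> holds M g)"

definition skeptical_consequence :: "program \<Rightarrow> fm \<Rightarrow> bool" where
  "skeptical_consequence P F \<longleftrightarrow> (\<forall>M. stable_model P M \<longrightarrow> holds M F)"

definition dep :: "program \<Rightarrow> (atm \<times> atm) set" where
  "dep P = {(A, B) | A B r. r \<in> Ground P \<and> A \<in> set (head r) \<and> B \<in> rule_atms r}"

definition finitely_recursive :: "program \<Rightarrow> bool" where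
  "finitely_recursive P \<longleftrightarrow> (\<forall>A\<in>HB P. finite {B. (A, B) \<in> (dep P)\<^sup>*})"

inductive prim_rec :: "nat \<Rightarrow> (nat list \<Rightarrow> nat) \<Rightarrow> bool" where
  zero: "prim_rec n (\<lambda>xs. 0)"
| succ: "prim_rec 1 (\<lambda>xs. Suc (hd xs))"
| proj: "i < n \<Longrightarrow> prim_rec n (\<lambda>xs. xs ! i)"
| comp: "prim_rec m g \<Longrightarrow> length gs = m \<Longrightarrow> (\<forall>h\<in>set gs. prim_rec n h) \<Longrightarrow>
           prim_rec n (\<lambda>xs. g (map (\<lambda>h. h xs) gs))"
| recur: "prim_rec n g \<Longrightarrow> prim_rec (n + 2) h \<Longrightarrow>
           prim_rec (Suc n) (\<lambda>xs. rec_nat (g (tl xs)) (\<lambda>k acc. h (k # acc # tl xs)) (hd xs))"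

text \<open>Semidecidability of a promise problem (domain D): a set is semidecidable
  iff it is Sigma_1, i.e. the projection of a primitive recursive relation
  (Kleene normal form: the procedure has halted positively within n steps).\<close>
definition semidecidable_on :: "nat set \<Rightarrow> nat set \<Rightarrow> bool" where
  "semidecidable_on D S \<longleftrightarrow>
     (\<exists>f. prim_rec 2 f \<and> (\<forall>x\<in>D. x \<in> S \<longleftrightarrow> (\<exists>n. f [x, n] = 0)))"

fun enc_trm :: "trm \<Rightarrow> nat" where
  "enc_trm (Var v) = sum_encode (Inl v)"
| "enc_trm (Fn f ts) = sum_encode (Inr (prod_encode (f, list_encode (map enc_trm ts))))"

fun enc_atm :: "atm \<Rightarrow> nat" where
  "enc_atm (Atom p ts) = prod_encode (p, list_encode (map enc_trm ts))"

fun enc_lit :: "lit \<Rightarrow> nat" where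
  "enc_lit (Pos a) = sum_encode (Inl (enc_atm a))"
| "enc_lit (Neg a) = sum_encode (Inr (enc_atm a))"

fun enc_rule :: "rule \<Rightarrow> nat" where
  "enc_rule (Rule hs bs) = prod_encode (list_encode (map enc_atm hs), list_encode (map enc_lit bs))"

definition enc_prog :: "program \<Rightarrow> nat" where
  "enc_prog P = list_encode (map enc_rule P)"

fun enc_fm :: "fm \<Rightarrow> nat" where
  "enc_fm (FAtom a) = prod_encode (0, enc_atm a)"
| "enc_fm (FNot f) = prod_encode (1, enc_fm f)"
| "enc_fm (FAnd f g) = prod_encode (2, prod_encode (enc_fm f, enc_fm g))"
| "enc_fm (FOr f g) = prod_encode (3, prod_encode (enc_fm f, enc_fm g))"
| "enc_fm (FImp f g) = prod_encode (4, prod_encode (enc_fm f, enc_fm g))"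

definition enc_input :: "program \<Rightarrow> fm \<Rightarrow> nat" where
  "enc_input P F = prod_encode (enc_prog P, enc_fm F)"

end

theory Submission
  imports Defs
begin

text \<open>
  If U is a finite set of ground atoms closed under dependency, then M restricted to U is a stable
  model of the ground rules with head in U, for every stable model M of P. Conversely, stable models
  of these finite bottom parts that violate F form a finitely branching tree as U grows, and by
  Koenig's lemma an infinite branch yields a stable model of P violating F. Hence F is a skeptical
  consequence iff some finite closed U containing the atoms of F has the property that all stable
  models of its bottom part satisfy F.

  Closedness of U ranges over infinitely many instances, but for U consisting of atoms of term depth
  at most n it suffices to test the instances of depth n + 1: either all ground terms have depth at
  most n, or there is a term of depth exactly n + 1 that stands for all terms too deep to occur in U.
  So the search is a bounded computation for each n.
\<close>

section \<open>Primitive recursive functions on numbers\<close>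

text \<open>Semidecidability is stated here as a Kleene normal form over \<open>prim_rec\<close>, so
  it is not enough to describe the search: the test for a single n must be a primitive recursive
  function of the code of the input. Much of the effort goes there. \<open>prim_rec\<close> knows
  only numbers and one recursion scheme, while the test ranges over subsets, substitutions and
  subterms. The predicate \<open>pr\<close> bridges the gap: a function between encodable types is
  represented by a unary function on codes, each building block of the test gets a closure rule, and
  structural recursion on lists, terms and formulas becomes course-of-values recursion, because the
  codes of the parts are smaller than the code of the whole. On the logical side, finite
  recursiveness keeps the dependency closure of a finite set of atoms finite. This supplies the
  exhausting sequence of finite closed sets for Koenig's lemma, and hence a certificate that appears
  at some finite n.\<close>

definition prn :: "nat \<Rightarrow> (nat list \<Rightarrow> nat) \<Rightarrow> bool" where
  "prn n F \<longleftrightarrow> (\<exists>g. prim_rec n g \<and> (\<forall>xs. length xs = n \<longrightarrow> g xs = F xs))"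

lemma prn_proj: "i < n \<Longrightarrow> prn n (\<lambda>xs. xs ! i)"
  unfolding prn_def using prim_rec.proj by blast

lemma prn_comp:
  assumes "prn (length Fs) G" "\<And>F. F \<in> set Fs \<Longrightarrow> prn n F"
  shows "prn n (\<lambda>xs. G (map (\<lambda>F. F xs) Fs))"
proof -
  obtain g where g: "prim_rec (length Fs) g" "\<And>xs. length xs = length Fs \<Longrightarrow> g xs = G xs"
    using assms(1) unfolding prn_def by blast
  obtain c where c: "\<And>F. F \<in> set Fs \<Longrightarrow> prim_rec n (c F) \<and> (\<forall>xs. length xs = n \<longrightarrow> c F xs = F xs)"
    using assms(2) unfolding prn_def by metis
  have "prim_rec n (\<lambda>xs. g (map (\<lambda>h. h xs) (map c Fs)))"
    by (rule prim_rec.comp[OF g(1)]) (use c in auto)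
  moreover have "g (map (\<lambda>h. h xs) (map c Fs)) = G (map (\<lambda>F. F xs) Fs)" if "length xs = n" for xs
  proof -
    have "map (\<lambda>h. h xs) (map c Fs) = map (\<lambda>F. F xs) Fs" using c that by auto
    then show ?thesis by (simp only: g(2) length_map)
  qed
  ultimately show ?thesis unfolding prn_def by blast
qed

lemma prn_comp1: "prn 1 (\<lambda>xs. f (xs ! 0)) \<Longrightarrow> prn n F \<Longrightarrow> prn n (\<lambda>xs. f (F xs))"
  using prn_comp[of "[F]" "\<lambda>xs. f (xs ! 0)" n] by simp

lemma prn_comp2: "prn 2 (\<lambda>xs. f (xs ! 0) (xs ! 1)) \<Longrightarrow> prn n F \<Longrightarrow> prn n G \<Longrightarrow> prn n (\<lambda>xs. f (F xs) (G xs))"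
  using prn_comp[of "[F, G]" "\<lambda>xs. f (xs ! 0) (xs ! 1)" n] by (auto simp: numeral_2_eq_2)

lemma prn_Suc:
  assumes "prn n F" shows "prn n (\<lambda>xs. Suc (F xs))"
proof (rule prn_comp1[OF _ assms])
  \<comment> \<open>\<open>hd\<close> and \<open>! 0\<close> can be identified only on nonempty
    lists; this is why \<open>prn\<close> compares functions on lists of the right length
    alone.\<close>
  have "Suc (hd xs) = Suc (xs ! 0)" if "length xs = 1" for xs :: "nat list"
    using that by (cases xs) auto
  then show "prn 1 (\<lambda>xs. Suc (xs ! 0))" unfolding prn_def using prim_rec.succ by blast
qed

lemma prn_const: "prn n (\<lambda>xs. c)"
proof (induction c)
  case 0
  show ?case unfolding prn_def using prim_rec.zero by blast
next
  case (Suc c)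
  then show ?case by (rule prn_Suc)
qed

text \<open>\<open>recur\<close> insists on recursing over the first argument and hides it from the
  step function. Composing it with \<open>B\<close> followed by all n projections turns this into
  recursion up to a computed bound with every argument available as a parameter.\<close>

lemma prn_rec:
  assumes B: "prn n B" and G: "prn n G" and H: "prn (n + 2) H"
  shows "prn n (\<lambda>xs. rec_nat (G xs) (\<lambda>k acc. H (k # acc # xs)) (B xs))"
proof -
  obtain g h where g: "prim_rec n g" "\<And>xs. length xs = n \<Longrightarrow> g xs = G xs"
    and h: "prim_rec (n + 2) h" "\<And>xs. length xs = n + 2 \<Longrightarrow> h xs = H xs"
    using G H unfolding prn_def by blast
  define R where "R = (\<lambda>xs. rec_nat (g (tl xs)) (\<lambda>k acc. h (k # acc # tl xs)) (hd xs))"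
  let ?Fs = "B # map (\<lambda>i xs. xs ! i) [0..<n]"
  have "prim_rec (Suc n) R" unfolding R_def by (rule prim_rec.recur[OF g(1) h(1)])
  then have "prn (Suc n) R" unfolding prn_def by blast
  then have "prn n (\<lambda>xs. R (map (\<lambda>F. F xs) ?Fs))"
    by (intro prn_comp) (auto simp: B prn_proj)
  moreover have "R (map (\<lambda>F. F xs) ?Fs) = rec_nat (G xs) (\<lambda>k acc. H (k # acc # xs)) (B xs)"
    if l: "length xs = n" for xs
  proof -
    have "map (\<lambda>F. F xs) ?Fs = B xs # xs"
      using l by (auto simp: o_def intro: nth_equalityI)
    then show ?thesis by (simp only: R_def list.sel) (simp add: g(2) h(2) l)
  qed
  ultimately show ?thesis unfolding prn_def by auto
qed

definition prec1 :: "(nat \<Rightarrow> nat) \<Rightarrow> bool" where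
  "prec1 f \<longleftrightarrow> prn 1 (\<lambda>xs. f (xs ! 0))"

definition prec2 :: "(nat \<Rightarrow> nat \<Rightarrow> nat) \<Rightarrow> bool" where
  "prec2 f \<longleftrightarrow> prn 2 (\<lambda>xs. f (xs ! 0) (xs ! 1))"

lemmas prn1 = prn_comp1[folded prec1_def]
lemmas prn2 = prn_comp2[folded prec2_def]

lemma prec1_comp: "prec1 f \<Longrightarrow> prec1 g \<Longrightarrow> prec1 (\<lambda>x. f (g x))"
  unfolding prec1_def by (rule prn_comp1)

lemma prec2_comp: "prec2 f \<Longrightarrow> prec1 g \<Longrightarrow> prec1 h \<Longrightarrow> prec1 (\<lambda>x. f (g x) (h x))"
  unfolding prec1_def prec2_def by (rule prn_comp2)

lemma prec1_id: "prec1 (\<lambda>x. x)"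
  unfolding prec1_def by (rule prn_proj) simp

lemma prec1_const: "prec1 (\<lambda>x. c)"
  unfolding prec1_def by (rule prn_const)

lemma prec1_Suc: "prec1 f \<Longrightarrow> prec1 (\<lambda>x. Suc (f x))"
  unfolding prec1_def by (rule prn_Suc)

lemma prec1_rec_simple:
  assumes "prec2 h"
  shows "prec1 (\<lambda>x. rec_nat c h x)"
proof -
  have "prn 3 (\<lambda>xs. h (xs ! 0) (xs ! 1))"
    by (rule prn2[OF assms]) (auto intro: prn_proj)
  from prn_rec[OF prn_proj[of 0 1] prn_const[of 1 c], of "\<lambda>xs. h (xs ! 0) (xs ! 1)"] this
  show ?thesis unfolding prec1_def by (simp add: numeral_3_eq_3 eta_contract_eq)
qed

lemma prec2_add: "prec2 (+)"
proof -
  have "prn 2 (\<lambda>xs. rec_nat (xs ! 1) (\<lambda>k acc. Suc ((k # acc # xs) ! 1)) (xs ! 0))"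
    by (intro prn_rec prn_proj prn_Suc) auto
  moreover have "rec_nat b (\<lambda>k acc. Suc acc) a = a + b" for a b :: nat
    by (induction a) auto
  ultimately show ?thesis unfolding prec2_def by simp
qed

lemma prec1_pred: "prec1 (\<lambda>x. x - 1)"
proof -
  have "prec2 (\<lambda>a b. a)" unfolding prec2_def by (rule prn_proj) simp
  then have "prec1 (\<lambda>x. rec_nat 0 (\<lambda>a b. a) x)" by (rule prec1_rec_simple)
  moreover have "rec_nat 0 (\<lambda>a b. a) x = x - 1" for x :: nat by (cases x) auto
  ultimately show ?thesis by simp
qed

lemma prec2_diff: "prec2 (-)"
proof -
  have "prn 2 (\<lambda>xs. rec_nat (xs ! 0) (\<lambda>k acc. (k # acc # xs) ! 1 - 1) (xs ! 1))"
    by (intro prn_rec prn_proj prn1[OF prec1_pred]) auto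
  moreover have "rec_nat a (\<lambda>k acc. acc - 1) b = a - b" for a b :: nat
    by (induction b) auto
  ultimately show ?thesis unfolding prec2_def by simp
qed

lemma prec1_triangle: "prec1 triangle"
proof -
  have "prec2 (\<lambda>a b. b + Suc a)" unfolding prec2_def
    by (intro prn2[OF prec2_add] prn_Suc prn_proj) auto
  then have "prec1 (\<lambda>x. rec_nat 0 (\<lambda>a b. b + Suc a) x)" by (rule prec1_rec_simple)
  moreover have "rec_nat 0 (\<lambda>a b. b + Suc a) x = triangle x" for x :: nat by (induction x) auto
  ultimately show ?thesis by simp
qed

lemma prec2_prod_encode: "prec2 (\<lambda>a b. prod_encode (a, b))"
  unfolding prec2_def prod_encode_def split
  by (intro prn2[OF prec2_add] prn1[OF prec1_triangle] prn_proj) auto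

lemma prec2_if_zero: "prec2 (\<lambda>a b. if a = 0 then b else 0)"
proof -
  have "prn 2 (\<lambda>xs. rec_nat (xs ! 1) (\<lambda>k acc. 0) (xs ! 0))"
    by (intro prn_rec prn_proj prn_const) auto
  moreover have "rec_nat b (\<lambda>k acc. 0) a = (if a = 0 then b else 0)" for a b :: nat
    by (cases a) auto
  ultimately show ?thesis unfolding prec2_def by (simp only:)
qed

text \<open>Walking along the Cantor enumeration, the antidiagonal index increases exactly when
  the current antidiagonal is exhausted.\<close>

definition diagonal :: "nat \<Rightarrow> nat" where
  "diagonal = rec_nat 0 (\<lambda>k s. s + (if triangle s + s - k = 0 then 1 else 0))"

lemma diagonal_prod_encode: "diagonal (prod_encode (a, b)) = a + b"
proof -
  have "\<exists>a b. prod_encode (a, b) = x \<and> diagonal x = a + b" for x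
  proof (induction x)
    case 0
    show ?case by (intro exI[of _ 0]) (simp add: diagonal_def prod_encode_def)
  next
    case (Suc x)
    then obtain a b where ab: "prod_encode (a, b) = x" "diagonal x = a + b" by blast
    \<comment> \<open>One step of the walk goes from (a, b' + 1) to (a + 1, b'), or from (a, 0) to
      the start (0, a + 1) of the next antidiagonal.\<close>
    show ?case
    proof (cases b)
      case 0
      have "diagonal (Suc x) = 0 + Suc a"
        using ab 0 by (simp add: diagonal_def prod_encode_def)
      moreover have "prod_encode (0, Suc a) = Suc x" using ab 0 by (simp add: prod_encode_def)
      ultimately show ?thesis by blast
    next
      case (Suc b')
      have "diagonal (Suc x) = Suc a + b'"
        using ab Suc by (simp add: diagonal_def prod_encode_def)
      moreover have "prod_encode (Suc a, b') = Suc x" using ab Suc by (simp add: prod_encode_def)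
      ultimately show ?thesis by blast
    qed
  qed
  then show ?thesis by (metis Pair_inject prod_encode_eq)
qed

lemma prec1_diagonal: "prec1 diagonal"
  unfolding diagonal_def
  by (rule prec1_rec_simple, unfold prec2_def,
      intro prn2[OF prec2_add] prn2[OF prec2_diff] prn2[OF prec2_if_zero] prn1[OF prec1_triangle] prn_proj prn_const) auto

lemma prec1_fst_decode: "prec1 (\<lambda>x. fst (prod_decode x))"
proof -
  \<comment> \<open>The code of (a, b) is \<open>triangle (a + b) + a\<close>, and
    \<open>diagonal\<close> yields a + b.\<close>
  have "prec1 (\<lambda>x. x - triangle (diagonal x))"
    by (intro prec2_comp[OF prec2_diff] prec1_comp[OF prec1_triangle] prec1_diagonal prec1_id)
  moreover have "x - triangle (diagonal x) = fst (prod_decode x)" for x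
  proof -
    obtain a b where x: "x = prod_encode (a, b)" by (metis prod_decode_inverse surj_pair)
    show ?thesis unfolding x diagonal_prod_encode by simp (simp add: prod_encode_def)
  qed
  ultimately show ?thesis by simp
qed

lemma prec1_snd_decode: "prec1 (\<lambda>x. snd (prod_decode x))"
proof -
  have "prec1 (\<lambda>x. diagonal x - fst (prod_decode x))"
    by (intro prec2_comp[OF prec2_diff] prec1_fst_decode prec1_diagonal prec1_id)
  moreover have "diagonal x - fst (prod_decode x) = snd (prod_decode x)" for x
  proof -
    obtain a b where x: "x = prod_encode (a, b)" by (metis prod_decode_inverse surj_pair)
    show ?thesis by (simp add: x diagonal_prod_encode)
  qed
  ultimately show ?thesis by simp
qed

text \<open>Packing parameter, counter and accumulator into one number keeps everything unary, so
  that later closure rules need no arities.\<close>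

lemma prec1_rec:
  assumes B: "prec1 B" and G: "prec1 G" and H: "prec1 H"
  shows "prec1 (\<lambda>x. rec_nat (G x) (\<lambda>k acc. H (prod_encode (x, prod_encode (k, acc)))) (B x))"
proof -
  let ?h = "\<lambda>xs::nat list. H (prod_encode (xs ! 2, prod_encode (xs ! 0, xs ! 1)))"
  have "prn 3 ?h"
    by (intro prn1[OF H] prn2[OF prec2_prod_encode] prn_proj) auto
  then have "prn 1 (\<lambda>xs. rec_nat (G (xs ! 0)) (\<lambda>k acc. ?h (k # acc # xs)) (B (xs ! 0)))"
    by (intro prn_rec prn1[OF G] prn1[OF B] prn_proj) (auto simp: numeral_3_eq_3)
  then show ?thesis unfolding prec1_def by (simp add: numeral_2_eq_2)
qed

section \<open>Primitive recursive functions on encodable types\<close>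

text \<open>The instances below are chosen to coincide with the encodings of the problem statement,
  so results about \<open>gnum\<close> speak directly about \<open>enc_input\<close>. Injectivity
  makes equality of values decidable on codes.\<close>

class encodable =
  fixes gnum :: "'a \<Rightarrow> nat"
  assumes gnum_inject: "gnum x = gnum y \<longleftrightarrow> x = y"

instantiation nat :: encodable
begin
definition "gnum (n::nat) = n"
instance by standard (simp add: gnum_nat_def)
end

instantiation bool :: encodable
begin
definition "gnum (b::bool) = (if b then 1 else 0)"
instance by standard (simp add: gnum_bool_def)
end

instantiation prod :: (encodable, encodable) encodable
begin
definition "gnum p = prod_encode (gnum (fst p), gnum (snd p))"
instance by standard (simp add: gnum_prod_def gnum_inject prod_eq_iff)
end

instantiation list :: (encodable) encodable
begin
definition "gnum xs = list_encode (map gnum xs)"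
instance by standard (metis gnum_list_def gnum_inject inj_onI inj_map_eq_map list_encode_eq)
end

lemma gnum_Pair: "gnum (x, y) = prod_encode (gnum x, gnum y)"
  by (simp add: gnum_prod_def)

lemma gnum_Nil: "gnum [] = 0"
  by (simp add: gnum_list_def)

lemma gnum_Cons: "gnum (x # xs) = Suc (prod_encode (gnum x, gnum xs))"
  by (simp add: gnum_list_def)

lemma enc_trm_inject: "enc_trm s = enc_trm t \<longleftrightarrow> s = t"
proof (induction s arbitrary: t)
  case (Var v)
  then show ?case by (cases t) (auto simp: sum_encode_eq)
next
  case (Fn f ts)
  show ?case
  proof (cases t)
    case (Fn g us)
    have "map enc_trm ts = map enc_trm us \<Longrightarrow> ts = us"
      using Fn.IH by (auto simp: list_eq_iff_nth_eq)
    then show ?thesis using \<open>t = Fn g us\<close> by (auto simp: sum_encode_eq list_encode_eq)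
  qed (auto simp: sum_encode_eq)
qed

instantiation trm :: encodable
begin
definition "gnum = enc_trm"
instance by standard (simp add: gnum_trm_def enc_trm_inject)
end


lemma enc_atm_inject: "enc_atm a = enc_atm b \<longleftrightarrow> a = b"
  using gnum_inject[where 'a = "trm list"]
  by (cases a; cases b) (auto simp: gnum_list_def gnum_trm_def)

instantiation atm :: encodable
begin
definition "gnum = enc_atm"
instance by standard (simp add: gnum_atm_def enc_atm_inject)
end

lemma enc_lit_inject: "enc_lit a = enc_lit b \<longleftrightarrow> a = b"
  by (cases a; cases b) (auto simp: enc_atm_inject sum_encode_eq)

instantiation lit :: encodable
begin
definition "gnum = enc_lit"
instance by standard (simp add: gnum_lit_def enc_lit_inject)
end

lemma enc_rule_inject: "enc_rule r = enc_rule s \<longleftrightarrow> r = s"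
  using gnum_inject[where 'a = "atm list"] gnum_inject[where 'a = "lit list"]
  by (cases r; cases s) (auto simp: gnum_list_def gnum_atm_def gnum_lit_def)

instantiation rule :: encodable
begin
definition "gnum = enc_rule"
instance by standard (simp add: gnum_rule_def enc_rule_inject)
end

lemma enc_fm_inject: "enc_fm F = enc_fm G \<longleftrightarrow> F = G"
proof (induction F arbitrary: G)
qed (case_tac G; auto simp: enc_atm_inject)+

instantiation fm :: encodable
begin
definition "gnum = enc_fm"
instance by standard (simp add: gnum_fm_def enc_fm_inject)
end

lemma gnum_program_fm: "gnum (P, F) = enc_input P F"
  by (simp add: enc_input_def enc_prog_def gnum_Pair gnum_list_def gnum_rule_def gnum_fm_def)

text \<open>The representing function is constrained on codes only and may do anything on other
  numbers. Functions of several arguments are covered by taking pairs as input.\<close>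

definition pr :: "('a::encodable \<Rightarrow> 'b::encodable) \<Rightarrow> bool" where
  "pr f \<longleftrightarrow> (\<exists>g. prec1 g \<and> (\<forall>x. gnum (f x) = g (gnum x)))"

lemma prI: "prec1 g \<Longrightarrow> (\<And>x. gnum (f x) = g (gnum x)) \<Longrightarrow> pr f"
  unfolding pr_def by blast

lemma prE:
  assumes "pr f"
  obtains g where "prec1 g" "\<And>x. gnum (f x) = g (gnum x)"
  using assms unfolding pr_def by blast

named_theorems pr_intros

lemma pr_prec1: "pr f \<longleftrightarrow> prec1 f" for f :: "nat \<Rightarrow> nat"
  unfolding pr_def gnum_nat_def by (auto simp flip: fun_eq_iff)

lemma pr_id [pr_intros]: "pr (\<lambda>x. x)"
  by (rule prI[OF prec1_id]) simp

lemma pr_const [pr_intros]: "pr (\<lambda>x. c)"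
  by (rule prI[OF prec1_const]) simp

lemma pr_comp:
  assumes "pr f" "pr g"
  shows "pr (\<lambda>x. f (g x))"
proof -
  obtain f' g' where f': "prec1 f'" "\<And>x. gnum (f x) = f' (gnum x)"
    and g': "prec1 g'" "\<And>x. gnum (g x) = g' (gnum x)"
    by (rule prE[OF assms(1)], rule prE[OF assms(2)]) blast
  show ?thesis by (rule prI[OF prec1_comp[OF f'(1) g'(1)]]) (simp add: f' g')
qed

lemma pr_Pair [pr_intros]:
  assumes "pr f" "pr g"
  shows "pr (\<lambda>x. (f x, g x))"
proof -
  obtain f' g' where f': "prec1 f'" "\<And>x. gnum (f x) = f' (gnum x)"
    and g': "prec1 g'" "\<And>x. gnum (g x) = g' (gnum x)"
    by (rule prE[OF assms(1)], rule prE[OF assms(2)]) blast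
  show ?thesis by (rule prI[OF prec2_comp[OF prec2_prod_encode f'(1) g'(1)]]) (simp add: f' g' gnum_Pair)
qed

lemma pr_fst [pr_intros]: "pr f \<Longrightarrow> pr (\<lambda>x. fst (f x))"
  by (rule pr_comp, rule prI[OF prec1_fst_decode]) (simp add: gnum_prod_def)

lemma pr_snd [pr_intros]: "pr f \<Longrightarrow> pr (\<lambda>x. snd (f x))"
  by (rule pr_comp, rule prI[OF prec1_snd_decode]) (simp add: gnum_prod_def)

lemma pr_binary:
  fixes h :: "nat \<Rightarrow> nat \<Rightarrow> nat"
  assumes "prec2 h" "pr f" "pr g"
  shows "pr (\<lambda>x. h (f x) (g x))"
proof -
  obtain f' g' where f': "prec1 f'" "\<And>x. gnum (f x) = f' (gnum x)"
    and g': "prec1 g'" "\<And>x. gnum (g x) = g' (gnum x)"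
    by (rule prE[OF assms(2)], rule prE[OF assms(3)]) blast
  show ?thesis using f'(2) g'(2)
    by (intro prI[OF prec2_comp[OF assms(1) f'(1) g'(1)]]) (simp add: gnum_nat_def)
qed

lemmas pr_add [pr_intros] = pr_binary[OF prec2_add]
lemmas pr_diff [pr_intros] = pr_binary[OF prec2_diff]

lemma pr_Suc [pr_intros]: "pr f \<Longrightarrow> pr (\<lambda>x. Suc (f x))"
  by (rule pr_comp) (auto simp: pr_prec1 intro: prec1_Suc prec1_id)

text \<open>The step function takes its arguments through \<open>fst\<close> and \<open>snd\<close>
  of one nested pair. All rules with bound variables have this shape, so that the remaining goals
  are again of the form \<open>pr\<close> of a single abstraction and \<open>intro pr_intros\<close>
  can continue.\<close>

lemma pr_rec_nat [pr_intros]: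
  assumes "pr n" "pr a" and b: "pr (\<lambda>z. b (fst z) (fst (snd z)) (snd (snd z)))"
  shows "pr (\<lambda>x. rec_nat (a x) (\<lambda>k acc. b x k acc) (n x))"
proof -
  obtain n' a' where n': "prec1 n'" "\<And>x. gnum (n x) = n' (gnum x)"
    and a': "prec1 a'" "\<And>x. gnum (a x) = a' (gnum x)"
    by (rule prE[OF assms(1)], rule prE[OF assms(2)]) blast
  obtain b' where b': "prec1 b'" "\<And>z. gnum (b (fst z) (fst (snd z)) (snd (snd z))) = b' (gnum z)"
    by (rule prE[OF b]) blast
  have "gnum (rec_nat (a x) (\<lambda>k acc. b x k acc) k) =
    rec_nat (a' (gnum x)) (\<lambda>k acc. b' (prod_encode (gnum x, prod_encode (k, acc)))) k" for x k
    by (induction k) (use a' b'(2)[of "(x, k, acc)" for k acc] in \<open>auto simp: gnum_Pair gnum_nat_def\<close>)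
  then show ?thesis using n'(2)
    by (intro prI[OF prec1_rec[OF n'(1) a'(1) b'(1)]]) (simp add: gnum_nat_def)
qed

text \<open>Truth values are coded by 0 and 1, so that branching is a primitive recursion of length
  at most one.\<close>

lemma pr_of_bool: "pr (of_bool :: bool \<Rightarrow> nat)"
  by (rule prI[OF prec1_id]) (simp add: gnum_nat_def gnum_bool_def)

lemma pr_if [pr_intros]:
  assumes "pr P" "pr f" "pr g"
  shows "pr (\<lambda>x. if P x then f x else g x)"
proof -
  have "pr (\<lambda>x. rec_nat (g x) (\<lambda>_ _. f x) (of_bool (P x)))"
    by (intro pr_rec_nat pr_comp[OF pr_of_bool] pr_comp[OF assms(2)] assms pr_intros)
  moreover have "rec_nat (g x) (\<lambda>_ _. f x) (of_bool (P x)) = (if P x then f x else g x)" for x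
    by simp
  ultimately show ?thesis by simp
qed

lemma pr_eq_nat:
  fixes f g :: "'a::encodable \<Rightarrow> nat"
  assumes "pr f" "pr g"
  shows "pr (\<lambda>x. f x = g x)"
proof -
  have zero: "pr (\<lambda>n::nat. n = 0)"
  proof (rule prI)
    show "prec1 (\<lambda>n. 1 - n)" by (intro prec2_comp[OF prec2_diff] prec1_const prec1_id)
  qed (auto simp: gnum_nat_def gnum_bool_def)
  have "pr (\<lambda>x. (f x - g x) + (g x - f x) = 0)"
    by (intro pr_comp[OF zero] pr_intros assms)
  moreover have "(f x - g x) + (g x - f x) = 0 \<longleftrightarrow> f x = g x" for x by auto
  ultimately show ?thesis by simp
qed

lemma pr_gnum: "pr f \<Longrightarrow> pr (\<lambda>x. gnum (f x))"
  by (rule pr_comp) (auto intro: prI[OF prec1_id] simp: gnum_nat_def)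

lemma pr_eq [pr_intros]:
  assumes "pr f" "pr g"
  shows "pr (\<lambda>x. f x = g x)"
  using pr_eq_nat[OF pr_gnum[OF assms(1)] pr_gnum[OF assms(2)]] by (simp add: gnum_inject)

lemma pr_conj [pr_intros]: "pr P \<Longrightarrow> pr Q \<Longrightarrow> pr (\<lambda>x. P x \<and> Q x)"
  using pr_if[OF _ _ pr_const, of P Q False] unfolding if_bool_eq_disj by simp

lemma pr_not [pr_intros]: "pr P \<Longrightarrow> pr (\<lambda>x. \<not> P x)"
  using pr_eq[OF _ pr_const, of P False] by simp

lemma pr_disj [pr_intros]: "pr P \<Longrightarrow> pr Q \<Longrightarrow> pr (\<lambda>x. P x \<or> Q x)"
  using pr_not[OF pr_conj[OF pr_not pr_not], of P Q] by simp

lemma pr_imp [pr_intros]: "pr P \<Longrightarrow> pr Q \<Longrightarrow> pr (\<lambda>x. P x \<longrightarrow> Q x)"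
  unfolding imp_conv_disj by (intro pr_disj pr_not)


text \<open>Witnesses on codes are themselves treated as \<open>pr\<close> functions on
  \<open>nat\<close>, so they can be assembled with the same closure rules.\<close>

lemma prI_nat: "pr g \<Longrightarrow> (\<And>x. gnum (f x) = g (gnum x)) \<Longrightarrow> pr f" for g :: "nat \<Rightarrow> nat"
  unfolding pr_prec1 by (rule prI)

lemma prE_nat:
  assumes "pr f"
  obtains g :: "nat \<Rightarrow> nat" where "pr g" "\<And>x. gnum (f x) = g (gnum x)"
  using prE[OF assms] unfolding pr_prec1 by blast

text \<open>A pair of numbers is coded by its \<open>prod_encode\<close>, so on codes both this map
  and its inverse are the identity.\<close>

lemma pr_prod_encode: "pr f \<Longrightarrow> pr (\<lambda>x. prod_encode (f x))"
  by (rule pr_comp, rule prI[OF prec1_id]) (simp_all add: gnum_prod_def gnum_nat_def)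

lemma pr_prod_decode: "pr f \<Longrightarrow> pr (\<lambda>x. prod_decode (f x))"
  by (rule pr_comp, rule prI[OF prec1_id]) (simp_all add: gnum_prod_def gnum_nat_def)

lemma pr_div_2:
  fixes f :: "'a::encodable \<Rightarrow> nat"
  assumes "pr f"
  shows "pr (\<lambda>x. f x div 2)"
proof -
  \<comment> \<open>At stage k the accumulator is k div 2; it grows exactly when k is odd.\<close>
  have "rec_nat 0 (\<lambda>k acc. if k = acc + acc then acc else Suc acc) n = n div 2" for n :: nat
    by (induction n) (simp_all, presburger)
  moreover have "pr (\<lambda>x. rec_nat 0 (\<lambda>k acc. if k = acc + acc then acc else Suc acc) (f x))"
    by (intro pr_intros assms)
  ultimately show ?thesis by simp
qed

lemma pr_even:
  fixes f :: "'a::encodable \<Rightarrow> nat"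
  assumes "pr f"
  shows "pr (\<lambda>x. even (f x))"
proof -
  have "pr (\<lambda>x. f x = f x div 2 + f x div 2)"
    by (intro pr_intros pr_div_2 assms)
  moreover have "n = n div 2 + n div 2 \<longleftrightarrow> even n" for n :: nat by presburger
  ultimately show ?thesis by simp
qed

lemmas pr_nat_intros = pr_intros pr_prod_encode pr_prod_decode pr_div_2 pr_even

section \<open>Lists and course-of-values recursion on codes\<close>

lemma pr_Cons [pr_intros]: "pr f \<Longrightarrow> pr g \<Longrightarrow> pr (\<lambda>x. f x # g x)"
proof -
  assume "pr f" "pr g"
  have "pr (\<lambda>z :: 'b \<times> 'b list. fst z # snd z)"
  proof (rule prI_nat)
    show "pr (\<lambda>n::nat. Suc n)" by (intro pr_intros)
  qed (simp add: gnum_Cons gnum_prod_def)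
  from pr_comp[OF this pr_Pair[OF \<open>pr f\<close> \<open>pr g\<close>]] show ?thesis by simp
qed

lemma pr_case_list [pr_intros]:
  assumes "pr l" "pr a" "pr (\<lambda>z. b (fst z) (fst (snd z)) (snd (snd z)))"
  shows "pr (\<lambda>x. case l x of [] \<Rightarrow> a x | y # ys \<Rightarrow> b x y ys)"
proof -
  obtain l' where l': "pr l'" "\<And>x. gnum (l x) = l' (gnum x)" using assms(1) by (rule prE_nat) blast
  obtain a' where a': "pr a'" "\<And>x. gnum (a x) = a' (gnum x)" using assms(2) by (rule prE_nat) blast
  obtain b' where b': "pr b'" "\<And>z. gnum (b (fst z) (fst (snd z)) (snd (snd z))) = b' (gnum z)"
    using assms(3) by (rule prE_nat) blast
  show ?thesis
  proof (rule prI_nat)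
    show "pr (\<lambda>x. if l' x = 0 then a' x else b' (prod_encode (x, l' x - 1)))"
      by (intro pr_nat_intros l' a' pr_comp[OF b'(1)])
    show "gnum (case l x of [] \<Rightarrow> a x | y # ys \<Rightarrow> b x y ys) =
      (if l' (gnum x) = 0 then a' (gnum x) else b' (prod_encode (gnum x, l' (gnum x) - 1)))" for x
      using b'(2)[of "(x, y, ys)" for y ys]
      by (cases "l x") (simp_all add: a' gnum_Nil gnum_Cons gnum_Pair flip: l'(2))
  qed
qed

text \<open>The unspecified value hd [] is a constant, hence no obstacle.\<close>

lemma pr_hd [pr_intros]: "pr l \<Longrightarrow> pr (\<lambda>x. hd (l x))"
proof -
  assume "pr l"
  then have "pr (\<lambda>x. case l x of [] \<Rightarrow> hd [] | y # ys \<Rightarrow> y)" by (intro pr_intros)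
  moreover have "(case xs of [] \<Rightarrow> hd [] | y # ys \<Rightarrow> y) = hd xs" for xs :: "'b list"
    by (cases xs) auto
  ultimately show ?thesis by simp
qed

lemma pr_tl [pr_intros]: "pr l \<Longrightarrow> pr (\<lambda>x. tl (l x))"
  unfolding tl_def by (intro pr_intros)

lemma pr_drop [pr_intros]:
  assumes "pr n" "pr l"
  shows "pr (\<lambda>x. drop (n x) (l x))"
proof -
  have "rec_nat xs (\<lambda>_ acc. tl acc) n = drop n xs" for n and xs :: "'b list"
    by (induction n) (auto simp: drop_Suc tl_drop)
  moreover have "pr (\<lambda>x. rec_nat (l x) (\<lambda>_ acc. tl acc) (n x))"
    by (intro pr_intros assms)
  ultimately show ?thesis by simp
qed

text \<open>Course-of-values recursion on codes: the history lists the earlier values with the newest first,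
  so the value at k sits at position n - 1 - k of the history of length n.\<close>

primrec cov_history :: "('e \<times> nat \<times> 'b list \<Rightarrow> 'b) \<Rightarrow> 'e \<Rightarrow> nat \<Rightarrow> 'b list" where
  "cov_history H e 0 = []"
| "cov_history H e (Suc n) = H (e, n, cov_history H e n) # cov_history H e n"

definition cov :: "('e \<times> nat \<times> 'b list \<Rightarrow> 'b) \<Rightarrow> 'e \<Rightarrow> nat \<Rightarrow> 'b" where
  "cov H e n = H (e, n, cov_history H e n)"

definition lookup :: "nat \<Rightarrow> 'b list \<Rightarrow> nat \<Rightarrow> 'b" where
  "lookup n h k = hd (drop (n - Suc k) h)"

lemma lookup_cov_history: "k < n \<Longrightarrow> lookup n (cov_history H e n) k = cov H e k"
proof -
  have "k \<le> n \<Longrightarrow> drop (n - k) (cov_history H e n) = cov_history H e k" for k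
  proof (induction n)
    case (Suc n)
    then show ?case by (cases "k = Suc n") (auto simp: Suc_diff_le)
  qed simp
  from this[of "Suc k"] show "k < n \<Longrightarrow> ?thesis" by (simp add: lookup_def cov_def)
qed

lemma pr_cov:
  assumes "pr H" "pr e" "pr n"
  shows "pr (\<lambda>x. cov H (e x) (n x))"
proof -
  have hist: "cov_history H e n = rec_nat [] (\<lambda>k acc. H (e, k, acc) # acc) n" for e n
    by (induction n) auto
  show ?thesis unfolding cov_def hist
    by (intro pr_comp[OF assms(1)] pr_intros pr_comp[OF assms(2)] assms)
qed

lemma pr_lookup: "pr n \<Longrightarrow> pr h \<Longrightarrow> pr k \<Longrightarrow> pr (\<lambda>x. lookup (n x) (h x) (k x))"
  unfolding lookup_def by (intro pr_intros)

lemma prod_encode_less_Suc: "a < Suc (prod_encode (a, b))" "b < Suc (prod_encode (a, b))"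
  by (simp_all add: less_Suc_eq_le le_prod_encode_1 le_prod_encode_2)

text \<open>The tail of a list has a smaller code than the list, so the recursive value can be
  looked up in the history. A nonzero code z is taken apart by decoding z - 1; zero is the empty
  list.\<close>

lemma pr_rec_list [pr_intros]:
  assumes "pr l" "pr a" "pr (\<lambda>z. b (fst z) (fst (snd z)) (fst (snd (snd z))) (snd (snd (snd z))))"
  shows "pr (\<lambda>x. rec_list (a x) (\<lambda>y ys acc. b x y ys acc) (l x))"
proof -
  obtain l' where l': "pr l'" "\<And>x. gnum (l x) = l' (gnum x)" using assms(1) by (rule prE_nat) blast
  obtain a' where a': "pr a'" "\<And>x. gnum (a x) = a' (gnum x)" using assms(2) by (rule prE_nat) blast
  obtain b' where b': "pr b'"
    "\<And>z. gnum (b (fst z) (fst (snd z)) (fst (snd (snd z))) (snd (snd (snd z)))) = b' (gnum z)"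
    using assms(3) by (rule prE_nat) blast
  define H :: "nat \<times> nat \<times> nat list \<Rightarrow> nat" where
    "H = (\<lambda>(e, z, h). if z = 0 then a' e else
       b' (prod_encode (e, prod_encode (fst (prod_decode (z - 1)),
         prod_encode (snd (prod_decode (z - 1)),
           lookup z h (snd (prod_decode (z - 1))))))))"
  note H_eq = H_def[THEN fun_cong, of "(e, z, h)" for e z h, unfolded split]
  have H: "pr H" unfolding H_def case_prod_beta
    by (intro pr_comp[OF a'(1)] pr_comp[OF b'(1)] pr_nat_intros pr_lookup)
  have "gnum (rec_list (a x) (\<lambda>y ys acc. b x y ys acc) ys) = cov H (gnum x) (gnum ys)" for x ys
  proof (induction ys)
    case Nil
    show ?case by (simp add: cov_def H_eq gnum_Nil a')
  next
    case (Cons y ys)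
    then show ?case
      using b'(2)[of "(x, y, ys, acc)" for acc]
      \<comment> \<open>Only the outermost value is unfolded. The code of a nonempty list is a
        successor, so \<open>cov_history.simps\<close> is switched off to keep the history intact
        for \<open>lookup_cov_history\<close>.\<close>
      by (simp add: cov_def[of H _ "gnum (y # ys)"])
        (simp del: cov_history.simps add: H_eq gnum_Cons gnum_Pair lookup_cov_history prod_encode_less_Suc)
  qed
  then show ?thesis
    by (intro prI_nat[OF pr_cov[OF H pr_id l'(1)]]) (simp flip: l'(2))
qed

text \<open>At every number the recursion computes both the value of the term and the list of values of the
  term list that this number may encode.\<close>

lemma pr_rec_trm:
  fixes T :: "'e::encodable \<Rightarrow> trm \<Rightarrow> 'b::encodable"
  assumes T: "\<And>e v. T e (Var v) = a e v" "\<And>e f ts. T e (Fn f ts) = b e f ts (map (T e) ts)"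
    and "pr (\<lambda>z. a (fst z) (snd z))"
    and "pr (\<lambda>z. b (fst z) (fst (snd z)) (fst (snd (snd z))) (snd (snd (snd z))))"
    and "pr e" "pr t"
  shows "pr (\<lambda>x. T (e x) (t x))"
proof -
  obtain a' where a': "pr a'" "\<And>z. gnum (a (fst z) (snd z)) = a' (gnum z)" using assms(3) by (rule prE_nat) blast
  obtain b' where b': "pr b'"
    "\<And>z. gnum (b (fst z) (fst (snd z)) (fst (snd (snd z))) (snd (snd (snd z)))) = b' (gnum z)"
    using assms(4) by (rule prE_nat) blast
  obtain e' where e': "pr e'" "\<And>x. gnum (e x) = e' (gnum x)" using assms(5) by (rule prE_nat) blast
  obtain t' where t': "pr t'" "\<And>x. gnum (t x) = t' (gnum x)" using assms(6) by (rule prE_nat) blast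
  define H :: "nat \<times> nat \<times> (nat \<times> nat) list \<Rightarrow> nat \<times> nat" where
    \<comment> \<open>Read as a term, an even z is the variable z div 2, and an odd z has the pair
      of symbol and argument list coded by z div 2. Read as a list, z is empty or has head and tail
      coded by z - 1. The term value uses the list component of the arguments; the list value uses
      the term component of the head.\<close>
    "H = (\<lambda>(e, z, h).
      (if even z then a' (prod_encode (e, z div 2)) else
       b' (prod_encode (e, prod_encode (fst (prod_decode (z div 2)),
         prod_encode (snd (prod_decode (z div 2)),
           snd (lookup z h (snd (prod_decode (z div 2)))))))),
       if z = 0 then 0 else
         Suc (prod_encode (fst (lookup z h (fst (prod_decode (z - 1)))),
           snd (lookup z h (snd (prod_decode (z - 1))))))))"
  note H_eq = H_def[THEN fun_cong, of "(e, z, h)" for e z h, unfolded split]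
  have H: "pr H" unfolding H_def case_prod_beta
    by (intro pr_comp[OF a'(1)] pr_comp[OF b'(1)] pr_nat_intros pr_lookup)
  have list: "(\<And>t. t \<in> set ts \<Longrightarrow> fst (cov H (gnum e) (gnum t)) = gnum (T e t)) \<Longrightarrow>
    snd (cov H (gnum e) (gnum ts)) = gnum (map (T e) ts)" for e ts
  proof (induction ts)
    case Nil
    show ?case by (simp add: cov_def H_eq gnum_Nil)
  next
    case (Cons t ts)
    then show ?case
      by (simp add: cov_def[of H _ "gnum (t # ts)"])
        (simp del: cov_history.simps add: H_eq gnum_Cons gnum_Pair lookup_cov_history prod_encode_less_Suc)
  qed
  have gnum_Fn: "gnum (Fn f ts) = Suc (2 * prod_encode (f, gnum ts))" for f ts
    by (simp add: gnum_trm_def gnum_list_def sum_encode_def)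
  have gnum_Var: "gnum (Var v) = 2 * v" for v
    by (simp add: gnum_trm_def sum_encode_def)
  have "fst (cov H (gnum e) (gnum t)) = gnum (T e t)" for e t
  proof (induction t)
    case (Var v)
    then show ?case using a'(2)[of "(e, v)"]
      by (simp add: cov_def H_eq gnum_Var T gnum_Pair gnum_nat_def)
  next
    case (Fn f ts)
    have less: "gnum ts < gnum (Fn f ts)"
      using le_prod_encode_2[of "gnum ts" f] by (simp add: gnum_Fn)
    show ?case using b'(2)[of "(e, f, ts, map (T e) ts)"] list[OF Fn]
      by (simp add: cov_def[of H _ "gnum (Fn f ts)"])
       (use less in \<open>simp del: cov_history.simps add: H_eq gnum_Fn T gnum_Pair gnum_nat_def lookup_cov_history\<close>)
  qed
  then show ?thesis
    by (intro prI_nat[OF pr_fst[OF pr_cov[OF H e'(1) t'(1)]]]) (simp flip: e'(2) t'(2))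
qed

text \<open>The three binary connectives share one step function \<open>c\<close>, which receives
  the tag of the encoding as a number.\<close>

lemma pr_rec_fm:
  fixes T :: "'e::encodable \<Rightarrow> fm \<Rightarrow> 'b::encodable" and c :: "'e \<Rightarrow> nat \<Rightarrow> 'b \<Rightarrow> 'b \<Rightarrow> 'b"
  assumes T: "\<And>e A. T e (FAtom A) = a e A" "\<And>e F. T e (FNot F) = b e (T e F)"
    "\<And>e F G. T e (FAnd F G) = c e 2 (T e F) (T e G)"
    "\<And>e F G. T e (FOr F G) = c e 3 (T e F) (T e G)"
    "\<And>e F G. T e (FImp F G) = c e 4 (T e F) (T e G)"
    and "pr (\<lambda>z. a (fst z) (snd z))" "pr (\<lambda>z. b (fst z) (snd z))"
    and "pr (\<lambda>z. c (fst z) (fst (snd z)) (fst (snd (snd z))) (snd (snd (snd z))))"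
    and "pr e" "pr F"
  shows "pr (\<lambda>x. T (e x) (F x))"
proof -
  obtain a' where a': "pr a'" "\<And>z. gnum (a (fst z) (snd z)) = a' (gnum z)" using assms(6) by (rule prE_nat) blast
  obtain b' where b': "pr b'" "\<And>z. gnum (b (fst z) (snd z)) = b' (gnum z)" using assms(7) by (rule prE_nat) blast
  obtain c' where c': "pr c'"
    "\<And>z. gnum (c (fst z) (fst (snd z)) (fst (snd (snd z))) (snd (snd (snd z)))) = c' (gnum z)"
    using assms(8) by (rule prE_nat) blast
  obtain e' where e': "pr e'" "\<And>x. gnum (e x) = e' (gnum x)" using assms(9) by (rule prE_nat) blast
  obtain F' where F': "pr F'" "\<And>x. gnum (F x) = F' (gnum x)" using assms(10) by (rule prE_nat) blast
  define H :: "nat \<times> nat \<times> nat list \<Rightarrow> nat" where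
    "H = (\<lambda>(e, z, h).
      if fst (prod_decode z) = 0 then a' (prod_encode (e, snd (prod_decode z))) else
      if fst (prod_decode z) = 1 then
        b' (prod_encode (e, lookup z h (snd (prod_decode z)))) else
      c' (prod_encode (e, prod_encode (fst (prod_decode z),
         prod_encode (lookup z h (fst (prod_decode (snd (prod_decode z)))),
           lookup z h (snd (prod_decode (snd (prod_decode z))))))))) "
  note H_eq = H_def[THEN fun_cong, of "(e, z, h)" for e z h, unfolded split]
  have H: "pr H" unfolding H_def case_prod_beta
    by (intro pr_comp[OF a'(1)] pr_comp[OF b'(1)] pr_comp[OF c'(1)] pr_nat_intros pr_lookup)
  have gnum_fm: "gnum (FAtom A) = prod_encode (0, gnum A)" "gnum (FNot F) = prod_encode (1, gnum F)"
    "gnum (FAnd F G) = prod_encode (2, prod_encode (gnum F, gnum G))"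
    "gnum (FOr F G) = prod_encode (3, prod_encode (gnum F, gnum G))"
    "gnum (FImp F G) = prod_encode (4, prod_encode (gnum F, gnum G))" for A F G
    by (simp_all add: gnum_fm_def gnum_atm_def)
  \<comment> \<open>Strictness needs a positive tag, since \<open>prod_encode (0, 0) = 0\<close>.
    Only atoms have tag 0, and they require no lookup.\<close>
  have less: "0 < k \<Longrightarrow> n < prod_encode (k, n)" for k n
    using le_prod_encode_2[of n 0] by (induction n) (auto simp: prod_encode_def)
  have less': "0 < k \<Longrightarrow> m < prod_encode (k, prod_encode (m, n))"
    "0 < k \<Longrightarrow> n < prod_encode (k, prod_encode (m, n))" for k m n
    using le_prod_encode_1[of m n] le_prod_encode_2[of n m] less[of k "prod_encode (m, n)"] by auto
  have "cov H (gnum e) (gnum F) = gnum (T e F)" for e F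
  proof (induction F)
    case (FAtom A)
    then show ?case using a'(2)[of "(e, A)"]
      by (simp add: cov_def H_eq gnum_fm T gnum_Pair)
  next
    case (FNot F)
    then show ?case using b'(2)[of "(e, T e F)"]
      by (simp add: cov_def[of H _ "gnum (FNot F)"])
       (simp del: cov_history.simps add: H_eq gnum_fm T gnum_Pair less lookup_cov_history)
  next
    case (FAnd F G)
    then show ?case using c'(2)[of "(e, 2, T e F, T e G)"]
      by (simp add: cov_def[of H _ "gnum (FAnd F G)"])
       (simp del: cov_history.simps add: H_eq gnum_fm T gnum_Pair gnum_nat_def less' lookup_cov_history)
  next
    case (FOr F G)
    then show ?case using c'(2)[of "(e, 3, T e F, T e G)"]
      by (simp add: cov_def[of H _ "gnum (FOr F G)"])
       (simp del: cov_history.simps add: H_eq gnum_fm T gnum_Pair gnum_nat_def less' lookup_cov_history)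
  next
    case (FImp F G)
    then show ?case using c'(2)[of "(e, 4, T e F, T e G)"]
      by (simp add: cov_def[of H _ "gnum (FImp F G)"])
       (simp del: cov_history.simps add: H_eq gnum_fm T gnum_Pair gnum_nat_def less' lookup_cov_history)
  qed
  then show ?thesis
    by (intro prI_nat[OF pr_cov[OF H e'(1) F'(1)]]) (simp flip: e'(2) F'(2))
qed


section \<open>Bounded quantifiers and enumerations over lists\<close>

lemma pr_ball_set [pr_intros]:
  assumes "pr l" "pr (\<lambda>z. P (fst z) (snd z))"
  shows "pr (\<lambda>x. \<forall>y\<in>set (l x). P x y)"
proof -
  have "rec_list True (\<lambda>y _ acc. P x y \<and> acc) ys \<longleftrightarrow> (\<forall>y\<in>set ys. P x y)" for x ys
    by (induction ys) auto
  moreover have "pr (\<lambda>x. rec_list True (\<lambda>y _ acc. P x y \<and> acc) (l x))"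
    using pr_comp[OF assms(2), of "\<lambda>w. (fst w, fst (snd w))"]
    by (intro pr_intros assms) (simp add: pr_intros)
  ultimately show ?thesis by simp
qed

lemma pr_bex_set [pr_intros]:
  assumes "pr l" "pr (\<lambda>z. P (fst z) (snd z))"
  shows "pr (\<lambda>x. \<exists>y\<in>set (l x). P x y)"
proof -
  have "pr (\<lambda>x. \<not> (\<forall>y\<in>set (l x). \<not> P x y))"
    by (intro pr_intros assms)
  then show ?thesis by simp
qed

lemma pr_in_set [pr_intros]:
  assumes "pr f" "pr l"
  shows "pr (\<lambda>x. f x \<in> set (l x))"
proof -
  have "pr (\<lambda>x. \<exists>y\<in>set (l x). y = f x)"
    by (intro pr_intros pr_comp[OF assms(1)] assms)
  then show ?thesis by simp
qed

lemma pr_append [pr_intros]: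
  assumes "pr l" "pr l'"
  shows "pr (\<lambda>x. l x @ l' x)"
proof -
  have "rec_list zs (\<lambda>y _ acc. y # acc) ys = ys @ zs" for ys zs :: "'b list"
    by (induction ys) auto
  moreover have "pr (\<lambda>x. rec_list (l' x) (\<lambda>y _ acc. y # acc) (l x))"
    by (intro pr_intros assms)
  ultimately show ?thesis by simp
qed

lemma pr_concat [pr_intros]:
  assumes "pr l"
  shows "pr (\<lambda>x. concat (l x))"
proof -
  have "rec_list [] (\<lambda>y _ acc. y @ acc) ys = concat ys" for ys :: "'b list list"
    by (induction ys) auto
  moreover have "pr (\<lambda>x. rec_list [] (\<lambda>y _ acc. y @ acc) (l x))"
    by (intro pr_intros assms)
  ultimately show ?thesis by simp
qed

lemma pr_length [pr_intros]:
  assumes "pr l"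
  shows "pr (\<lambda>x. length (l x))"
proof -
  have "rec_list 0 (\<lambda>y _ acc. Suc acc) ys = length ys" for ys :: "'b list"
    by (induction ys) auto
  moreover have "pr (\<lambda>x. rec_list 0 (\<lambda>y _ acc. Suc acc) (l x))"
    by (intro pr_intros assms)
  ultimately show ?thesis by simp
qed

lemma pr_sum_list [pr_intros]:
  fixes l :: "'a::encodable \<Rightarrow> nat list"
  assumes "pr l"
  shows "pr (\<lambda>x. sum_list (l x))"
proof -
  have "rec_list 0 (\<lambda>y _ acc. y + acc) ys = sum_list ys" for ys :: "nat list"
    by (induction ys) auto
  moreover have "pr (\<lambda>x. rec_list 0 (\<lambda>y _ acc. y + acc) (l x))"
    by (intro pr_intros assms)
  ultimately show ?thesis by simp
qed

lemma pr_map [pr_intros]: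
  assumes "pr l" "pr (\<lambda>z. f (fst z) (snd z))"
  shows "pr (\<lambda>x. map (\<lambda>y. f x y) (l x))"
proof -
  have "rec_list [] (\<lambda>y _ acc. f x y # acc) ys = map (\<lambda>y. f x y) ys" for x ys
    by (induction ys) auto
  moreover have "pr (\<lambda>x. rec_list [] (\<lambda>y _ acc. f x y # acc) (l x))"
    using pr_comp[OF assms(2), of "\<lambda>w. (fst w, fst (snd w))"]
    by (intro pr_intros assms) (simp add: pr_intros)
  ultimately show ?thesis by simp
qed

lemma pr_subseqs [pr_intros]:
  assumes "pr l"
  shows "pr (\<lambda>x. subseqs (l x))"
proof -
  have "rec_list [[]] (\<lambda>y _ acc. map (\<lambda>ys. y # ys) acc @ acc) ys = subseqs ys" for ys :: "'b list"
    by (induction ys) (auto simp: Let_def)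
  moreover have "pr (\<lambda>x. rec_list [[]] (\<lambda>y _ acc. map (\<lambda>ys. y # ys) acc @ acc) (l x))"
    by (intro pr_intros assms)
  ultimately show ?thesis by simp
qed

lemma pr_n_lists [pr_intros]:
  assumes "pr n" "pr l"
  shows "pr (\<lambda>x. List.n_lists (n x) (l x))"
proof -
  have "rec_nat [[]] (\<lambda>_ acc. concat (map (\<lambda>ys. map (\<lambda>y. y # ys) zs) acc)) n = List.n_lists n zs"
    for n and zs :: "'b list"
    by (induction n) auto
  moreover have "pr (\<lambda>x. rec_nat [[]] (\<lambda>_ acc. concat (map (\<lambda>ys. map (\<lambda>y. y # ys) (l x)) acc)) (n x))"
    by (intro pr_intros pr_comp[OF assms(2)] assms)
  ultimately show ?thesis by simp
qed

section \<open>Herbrand universe and ground instances by term depth\<close>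

primrec trm_fsyms :: "trm \<Rightarrow> (nat \<times> nat) list" where
  "trm_fsyms (Var v) = []"
| "trm_fsyms (Fn f ts) = (f, length ts) # concat (map trm_fsyms ts)"

text \<open>A strict bound on the variable indices is all that is needed; the sum is crude but
  easily seen to be primitive recursive.\<close>

primrec var_bound :: "trm \<Rightarrow> nat" where
  "var_bound (Var v) = Suc v"
| "var_bound (Fn f ts) = sum_list (map var_bound ts)"

definition rule_atm_list :: "rule \<Rightarrow> atm list" where
  "rule_atm_list r = head r @ map lit_atm (body r)"

definition prog_atm_list :: "program \<Rightarrow> atm list" where
  "prog_atm_list P = concat (map rule_atm_list P)"

definition prog_args :: "program \<Rightarrow> trm list" where
  "prog_args P = concat (map args (prog_atm_list P))"

definition fsym_list :: "program \<Rightarrow> (nat \<times> nat) list" where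
  "fsym_list P = (if \<exists>c\<in>set (concat (map trm_fsyms (prog_args P))). snd c = 0
     then concat (map trm_fsyms (prog_args P)) else (0, 0) # concat (map trm_fsyms (prog_args P)))"

definition prog_var_bound :: "program \<Rightarrow> nat" where
  "prog_var_bound P = sum_list (map var_bound (prog_args P))"

text \<open>Level 0 is empty and constants have depth 1: the only argument list of length 0 over the
  empty level is \<open>[]\<close>.\<close>

primrec terms_upto :: "program \<Rightarrow> nat \<Rightarrow> trm list" where
  "terms_upto P 0 = []"
| "terms_upto P (Suc n) =
     concat (map (\<lambda>c. map (\<lambda>ts. Fn (fst c) ts) (List.n_lists (snd c) (terms_upto P n))) (fsym_list P))"

definition atoms_upto :: "program \<Rightarrow> nat \<Rightarrow> atm list" where
  "atoms_upto P n =
     concat (map (\<lambda>c. map (\<lambda>ts. Atom (fst c) ts) (List.n_lists (snd c) (terms_upto P n)))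
       (map psym (prog_atm_list P)))"

text \<open>Variables beyond the length of the list get the junk value hd []; instances of rules of P are
  only taken with lists of length prog_var_bound P, which exceeds all variables of P.\<close>

definition list_subst :: "trm list \<Rightarrow> nat \<Rightarrow> trm" where
  "list_subst s v = hd (drop v s)"

definition instances_upto :: "program \<Rightarrow> nat \<Rightarrow> rule list" where
  "instances_upto P n = concat (map (\<lambda>r. map (\<lambda>s. subst_rule (list_subst s) r)
     (List.n_lists (prog_var_bound P) (terms_upto P n))) P)"

lemma set_rule_atm_list [simp]: "set (rule_atm_list r) = rule_atms r"
  by (auto simp: rule_atm_list_def rule_atms_def)

lemma set_prog_atm_list [simp]: "set (prog_atm_list P) = prog_atms P"
  by (auto simp: prog_atm_list_def prog_atms_def)

lemma set_trm_fsyms: "set (trm_fsyms t) = fsyms_trm t"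
  by (induction t) auto

lemma set_fsym_list [simp]: "set (fsym_list P) = fsyms P"
proof -
  have "fsyms_atm a = (\<Union>t\<in>set (args a). fsyms_trm t)" for a by (cases a) simp
  then have S: "set (concat (map trm_fsyms (prog_args P))) = (\<Union>a\<in>prog_atms P. fsyms_atm a)"
    by (simp add: prog_args_def set_trm_fsyms)
  show ?thesis unfolding fsym_list_def fsyms_def Let_def S[symmetric] by (auto simp: Bex_def)
qed

lemma set_terms_upto_Suc: "set (terms_upto P (Suc n)) =
  {Fn f ts | f ts. (f, length ts) \<in> fsyms P \<and> set ts \<subseteq> set (terms_upto P n)}"
  by (auto simp: set_n_lists)

lemma terms_upto_mono_Suc: "set (terms_upto P n) \<subseteq> set (terms_upto P (Suc n))"
proof (induction n)
  case (Suc n)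
  show ?case
  proof
    fix t assume "t \<in> set (terms_upto P (Suc n))"
    then obtain f ts where t: "t = Fn f ts" "(f, length ts) \<in> fsyms P" "set ts \<subseteq> set (terms_upto P n)"
      unfolding set_terms_upto_Suc by blast
    then have "set ts \<subseteq> set (terms_upto P (Suc n))" using Suc by simp
    then show "t \<in> set (terms_upto P (Suc (Suc n)))"
      unfolding set_terms_upto_Suc[of P "Suc n"] using t(1,2) by (intro CollectI exI conjI)
  qed
qed simp

lemma terms_upto_mono: "m \<le> n \<Longrightarrow> set (terms_upto P m) \<subseteq> set (terms_upto P n)"
  by (rule lift_Suc_mono_le[of "\<lambda>n. set (terms_upto P n)"]) (rule terms_upto_mono_Suc)

lemma terms_upto_subterm: "Fn f ts \<in> set (terms_upto P n) \<Longrightarrow> set ts \<subseteq> set (terms_upto P n)"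
  using terms_upto_mono_Suc[of P "n - 1"]
  by (cases n) (auto simp: set_terms_upto_Suc simp del: terms_upto.simps(2))

lemma terms_upto_HU: "set (terms_upto P n) \<subseteq> HU P"
proof (induction n)
  case (Suc n)
  show ?case unfolding set_terms_upto_Suc using Suc by (auto intro!: HU.intros)
qed simp

lemma finite_subset_terms_upto:
  assumes "finite A" "A \<subseteq> (\<Union>n. set (terms_upto P n))"
  shows "\<exists>n. A \<subseteq> set (terms_upto P n)"
  using assms
proof (induction A)
  case (insert t A)
  then obtain m n where "t \<in> set (terms_upto P m)" "A \<subseteq> set (terms_upto P n)" by auto
  then have "insert t A \<subseteq> set (terms_upto P (max m n))"
    using terms_upto_mono[of m "max m n" P] terms_upto_mono[of n "max m n" P] by auto
  then show ?case by blast
qed simp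

lemma HU_eq_terms_upto: "HU P = (\<Union>n. set (terms_upto P n))"
proof
  show "HU P \<subseteq> (\<Union>n. set (terms_upto P n))"
  proof
    fix t assume "t \<in> HU P"
    then show "t \<in> (\<Union>n. set (terms_upto P n))"
    proof induction
      case (1 f ts)
      then obtain n where "set ts \<subseteq> set (terms_upto P n)"
        using finite_subset_terms_upto[of "set ts" P] by blast
      then have "Fn f ts \<in> set (terms_upto P (Suc n))" unfolding set_terms_upto_Suc using 1 by blast
      then show ?case by blast
    qed
  qed
qed (use terms_upto_HU in blast)

text \<open>A level that gains nothing is closed under all function symbols, and \<open>HU P\<close>
  is the least such set.\<close>

lemma HU_saturated:
  assumes "set (terms_upto P (Suc n)) \<subseteq> set (terms_upto P n)"
  shows "HU P \<subseteq> set (terms_upto P n)"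
proof
  fix t assume "t \<in> HU P"
  then show "t \<in> set (terms_upto P n)"
  proof induction
    case (1 f ts)
    then have "Fn f ts \<in> set (terms_upto P (Suc n))" unfolding set_terms_upto_Suc by blast
    then show ?case using assms by blast
  qed
qed

lemma set_atoms_upto: "set (atoms_upto P n) = {a. psym a \<in> psyms P \<and> set (args a) \<subseteq> set (terms_upto P n)}"
proof -
  have "set (atoms_upto P n) =
    (\<Union>c\<in>psyms P. Atom (fst c) ` {ts. length ts = snd c \<and> set ts \<subseteq> set (terms_upto P n)})"
    by (simp add: atoms_upto_def set_n_lists psyms_def)
  also have "\<dots> = {a. psym a \<in> psyms P \<and> set (args a) \<subseteq> set (terms_upto P n)}"
  proof (intro set_eqI)
    show "a \<in> (\<Union>c\<in>psyms P. Atom (fst c) ` {ts. length ts = snd c \<and> set ts \<subseteq> set (terms_upto P n)}) \<longleftrightarrow>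
      a \<in> {a. psym a \<in> psyms P \<and> set (args a) \<subseteq> set (terms_upto P n)}" for a
      by (cases a) (auto intro!: bexI[of _ "psym a"])
  qed
  finally show ?thesis .
qed

lemma atoms_upto_HB: "set (atoms_upto P n) \<subseteq> HB P"
  using terms_upto_HU by (auto simp: set_atoms_upto HB_def)

lemma finite_subset_atoms_upto:
  assumes "finite A" "A \<subseteq> HB P"
  shows "\<exists>n. A \<subseteq> set (atoms_upto P n)"
proof -
  have "finite (\<Union>a\<in>A. set (args a))" "(\<Union>a\<in>A. set (args a)) \<subseteq> (\<Union>n. set (terms_upto P n))"
    using assms by (auto simp: HB_def HU_eq_terms_upto)
  then obtain n where "(\<Union>a\<in>A. set (args a)) \<subseteq> set (terms_upto P n)"
    using finite_subset_terms_upto by blast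
  then show ?thesis using assms(2) by (auto simp: set_atoms_upto HB_def intro!: exI[of _ n])
qed

lemma rule_atms_subst: "rule_atms (subst_rule \<sigma> r) = subst_atm \<sigma> ` rule_atms r"
proof -
  have "lit_atm (subst_lit \<sigma> l) = subst_atm \<sigma> (lit_atm l)" for l by (cases l) auto
  then show ?thesis by (cases r) (auto simp: rule_atms_def image_image image_Un)
qed

lemma args_subst: "args (subst_atm \<sigma> a) = map (subst_trm \<sigma>) (args a)"
  by (cases a) simp

lemma psym_subst: "psym (subst_atm \<sigma> a) = psym a"
  by (cases a) simp

lemma subst_trm_HU: "fsyms_trm t \<subseteq> fsyms P \<Longrightarrow> (\<And>v. \<sigma> v \<in> HU P) \<Longrightarrow> subst_trm \<sigma> t \<in> HU P"
  by (induction t) (auto intro!: HU.intros simp: UN_subset_iff)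

lemma Ground_atms_HB:
  assumes "r \<in> Ground P"
  shows "rule_atms r \<subseteq> HB P"
proof -
  obtain r' \<sigma> where r: "r = subst_rule \<sigma> r'" "r' \<in> set P" "\<And>v. \<sigma> v \<in> HU P"
    using assms by (auto simp: Ground_def)
  have "subst_atm \<sigma> a \<in> HB P" if "a \<in> rule_atms r'" for a
  proof -
    have a: "a \<in> prog_atms P" using that r(2) by (auto simp: prog_atms_def)
    have "fsyms_trm t \<subseteq> fsyms P" if "t \<in> set (args a)" for t
    proof -
      have "fsyms_trm t \<subseteq> fsyms_atm a" using that by (cases a) auto
      then show ?thesis using a by (auto simp: fsyms_def Let_def)
    qed
    then show ?thesis using a r(3)
      by (auto simp: HB_def psym_subst args_subst psyms_def intro!: subst_trm_HU)
  qed
  then show ?thesis by (auto simp: r(1) rule_atms_subst)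
qed

lemma subst_rule_cong:
  assumes "\<And>a. a \<in> rule_atms r \<Longrightarrow> subst_atm \<sigma> a = subst_atm \<tau> a"
  shows "subst_rule \<sigma> r = subst_rule \<tau> r"
proof -
  have "lit_atm l \<in> rule_atms r \<Longrightarrow> subst_lit \<sigma> l = subst_lit \<tau> l" for l
    using assms by (cases l) auto
  then show ?thesis using assms by (cases r) (auto simp: rule_atms_def)
qed

lemma subst_atm_cong:
  "(\<And>t. t \<in> set (args a) \<Longrightarrow> subst_trm \<sigma> t = subst_trm \<tau> t) \<Longrightarrow> subst_atm \<sigma> a = subst_atm \<tau> a"
  by (cases a) auto

lemma subst_trm_var_bound:
  "(\<And>v. v < var_bound t \<Longrightarrow> \<sigma> v = \<tau> v) \<Longrightarrow> subst_trm \<sigma> t = subst_trm \<tau> t"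
proof (induction t)
  case (Fn f ts)
  have "subst_trm \<sigma> t = subst_trm \<tau> t" if t: "t \<in> set ts" for t
  proof -
    have "var_bound t \<le> var_bound (Fn f ts)" using t by (simp add: member_le_sum_list)
    then show ?thesis using Fn t by simp
  qed
  then show ?case by simp
qed simp

text \<open>Terms of depth at most n contain only subterms of depth at most n, so an instance of that
  depth does not see how the substitution acts on the variables mapped to deeper terms.\<close>

lemma subst_trm_agree:
  assumes "\<And>v. \<sigma> v \<in> set (terms_upto P n) \<Longrightarrow> \<tau> v = \<sigma> v"
  shows "subst_trm \<sigma> t \<in> set (terms_upto P n) \<Longrightarrow> subst_trm \<tau> t = subst_trm \<sigma> t"
proof (induction t)
  case (Fn f ts)
  have "set (map (subst_trm \<sigma>) ts) \<subseteq> set (terms_upto P n)"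
    using terms_upto_subterm Fn.prems by (metis subst_trm.simps(2))
  then show ?case using Fn.IH by auto
qed (use assms in simp)

lemma subst_atm_agree:
  assumes "\<And>v. \<sigma> v \<in> set (terms_upto P n) \<Longrightarrow> \<tau> v = \<sigma> v" "subst_atm \<sigma> a \<in> set (atoms_upto P n)"
  shows "subst_atm \<tau> a = subst_atm \<sigma> a"
  using assms(2)
  by (intro subst_atm_cong subst_trm_agree[OF assms(1)]) (auto simp: set_atoms_upto args_subst)

lemma instances_upto_Ground: "set (instances_upto P n) \<subseteq> Ground P"
proof
  fix g assume "g \<in> set (instances_upto P n)"
  then obtain r s where g: "g = subst_rule (list_subst s) r" and r: "r \<in> set P"
    and s: "length s = prog_var_bound P" "set s \<subseteq> set (terms_upto P n)"
    by (auto simp: instances_upto_def set_n_lists)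
  have "\<exists>c. (c, 0) \<in> fsyms P" unfolding fsyms_def Let_def by (simp only: split: if_split) blast
  then obtain c where "(c, 0) \<in> fsyms P" by blast
  then have c: "Fn c [] \<in> HU P" by (intro HU.intros) auto
  \<comment> \<open>\<open>Ground\<close> requires every variable to be mapped into
    \<open>HU P\<close>, so the junk values beyond the list are replaced by a constant, which
    \<open>fsyms\<close> always provides.\<close>
  define \<sigma> where "\<sigma> v = (if v < length s then list_subst s v else Fn c [])" for v
  have "\<sigma> v \<in> HU P" for v
    using c s(2) terms_upto_HU[of P n]
    by (auto simp: \<sigma>_def list_subst_def hd_drop_conv_nth dest: nth_mem)
  moreover have "subst_rule \<sigma> r = g" unfolding g
  proof (intro subst_rule_cong subst_atm_cong subst_trm_var_bound)
    fix a t v assume "a \<in> rule_atms r" and "t \<in> set (args a)" and v: "v < var_bound t"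
    then have "t \<in> set (prog_args P)" using r by (auto simp: prog_args_def prog_atms_def)
    then have "var_bound t \<le> prog_var_bound P" by (simp add: prog_var_bound_def member_le_sum_list)
    then show "\<sigma> v = list_subst s v" using v s(1) by (simp add: \<sigma>_def)
  qed
  ultimately show "g \<in> Ground P" using r by (auto simp: Ground_def)
qed

lemma subst_rule_instances_upto:
  assumes "r \<in> set P" "\<And>v. \<sigma> v \<in> set (terms_upto P n)"
  shows "subst_rule \<sigma> r \<in> set (instances_upto P n)"
proof -
  define s where "s = map \<sigma> [0..<prog_var_bound P]"
  have "subst_rule \<sigma> r = subst_rule (list_subst s) r"
  proof (intro subst_rule_cong subst_atm_cong subst_trm_var_bound)
    fix a t v assume "a \<in> rule_atms r" and "t \<in> set (args a)" and v: "v < var_bound t"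
    then have "t \<in> set (prog_args P)" using assms(1) by (auto simp: prog_args_def prog_atms_def)
    then have "var_bound t \<le> prog_var_bound P" by (simp add: prog_var_bound_def member_le_sum_list)
    then show "\<sigma> v = list_subst s v" using v by (simp add: s_def list_subst_def hd_drop_conv_nth)
  qed
  moreover have "s \<in> set (List.n_lists (prog_var_bound P) (terms_upto P n))"
    using assms(2) by (auto simp: s_def set_n_lists)
  ultimately show ?thesis using assms(1) by (auto simp: instances_upto_def)
qed

text \<open>A variable mapped outside the terms of depth n can be redirected to a term of depth exactly
  n + 1, should there be one; the redirected instance leaves U unless the variable does not occur
  in the rule.\<close>

lemma Ground_touching_instances_upto:
  assumes U: "U \<subseteq> set (atoms_upto P n)"
    and closed: "\<And>g. g \<in> set (instances_upto P (Suc n)) \<Longrightarrow> set (head g) \<inter> U \<noteq> {} \<Longrightarrow> rule_atms g \<subseteq> U"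
    and r: "r \<in> Ground P" "set (head r) \<inter> U \<noteq> {}"
  shows "r \<in> set (instances_upto P (Suc n))"
proof -
  let ?T = "\<lambda>n. set (terms_upto P n)"
  obtain r' \<sigma> where r': "r = subst_rule \<sigma> r'" "r' \<in> set P" "\<And>v. \<sigma> v \<in> HU P"
    using r(1) by (auto simp: Ground_def)
  \<comment> \<open>Besides staying within depth n + 1, \<open>\<tau>\<close> agrees with
    \<open>\<sigma>\<close> wherever either of the two gives a term of depth at most n. The two
    implications serve opposite directions of transfer below.\<close>
  obtain \<tau> where \<tau>: "\<And>v. \<tau> v \<in> ?T (Suc n)" "\<And>v. \<sigma> v \<in> ?T n \<Longrightarrow> \<tau> v = \<sigma> v"
    "\<And>v. \<tau> v \<in> ?T n \<Longrightarrow> \<sigma> v = \<tau> v"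
  proof (cases "?T (Suc n) \<subseteq> ?T n")
    case True
    then have "\<sigma> v \<in> ?T (Suc n)" for v
      using HU_saturated r'(3) terms_upto_mono_Suc by blast
    then show ?thesis by (intro that[of \<sigma>]) auto
  next
    case False
    then obtain t where "t \<in> ?T (Suc n)" "t \<notin> ?T n" by blast
    then show ?thesis using terms_upto_mono_Suc[of P n]
      by (intro that[of "\<lambda>v. if \<sigma> v \<in> ?T n then \<sigma> v else t"]) (auto split: if_splits simp del: terms_upto.simps)
  qed
  have g: "subst_rule \<tau> r' \<in> set (instances_upto P (Suc n))"
    by (rule subst_rule_instances_upto[OF r'(2) \<tau>(1)])
  obtain h where h: "h \<in> set (head r')" "subst_atm \<sigma> h \<in> U"
    using r(2) r'(1) by (cases r') auto
  \<comment> \<open>The head atom in \<open>U\<close> is shallow, so \<open>\<tau>\<close> preserves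
    it and its instance touches \<open>U\<close> too. Closedness then makes all atoms of that
    instance shallow, which transfers agreement back to \<open>\<sigma>\<close> on the whole
    rule.\<close>
  then have "subst_atm \<tau> h = subst_atm \<sigma> h" using subst_atm_agree \<tau>(2) U by blast
  moreover have "subst_atm \<tau> h \<in> set (head (subst_rule \<tau> r'))" using h(1) by (cases r') auto
  ultimately have "set (head (subst_rule \<tau> r')) \<inter> U \<noteq> {}" using h(2) by auto
  then have "subst_atm \<tau> ` rule_atms r' \<subseteq> U" using closed[OF g] by (auto simp: rule_atms_subst)
  then have "subst_atm \<sigma> a = subst_atm \<tau> a" if "a \<in> rule_atms r'" for a
    using that \<tau>(3) U by (intro subst_atm_agree[of \<tau> P n \<sigma>]) auto
  then have "r = subst_rule \<tau> r'" unfolding r'(1) by (rule subst_rule_cong)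
  then show ?thesis using g by simp
qed

section \<open>Splitting and compactness of stable models\<close>

definition reduct_of :: "rule set \<Rightarrow> atm set \<Rightarrow> (atm set \<times> atm set) set" where
  "reduct_of R M = {(set (head r), pos_body r) | r. r \<in> R \<and> neg_body r \<inter> M = {}}"

text \<open>Working over an arbitrary rule set lets the full ground program and its finite bottom
  parts be treated alike; the Herbrand base is handled separately.\<close>

definition stable_in :: "rule set \<Rightarrow> atm set \<Rightarrow> bool" where
  "stable_in R M \<longleftrightarrow> is_model (reduct_of R M) M \<and> (\<forall>N. N \<subset> M \<longrightarrow> \<not> is_model (reduct_of R M) N)"

lemma stable_model_iff: "stable_model P M \<longleftrightarrow> M \<subseteq> HB P \<and> stable_in (Ground P) M"
  by (simp add: stable_model_def minimal_herbrand_model_def stable_in_def reduct_def reduct_of_def)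

lemma is_model_reduct_of: "is_model (reduct_of R M) N \<longleftrightarrow>
  (\<forall>r\<in>R. neg_body r \<inter> M = {} \<longrightarrow> pos_body r \<subseteq> N \<longrightarrow> set (head r) \<inter> N \<noteq> {})"
  by (auto simp: is_model_def reduct_of_def)

text \<open>For a splitting set \<open>U\<close> this is the bottom part of the program.\<close>

definition touching :: "atm set \<Rightarrow> rule set \<Rightarrow> rule set" where
  "touching U R = {r \<in> R. set (head r) \<inter> U \<noteq> {}}"

text \<open>Known as \<open>U\<close> being a splitting set.\<close>

definition closed_in :: "rule set \<Rightarrow> atm set \<Rightarrow> bool" where
  "closed_in R U \<longleftrightarrow> (\<forall>r\<in>touching U R. rule_atms r \<subseteq> U)"

lemma rule_atms_eq: "rule_atms r = set (head r) \<union> pos_body r \<union> neg_body r"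
proof -
  have "a \<in> lit_atm ` set (body r) \<longleftrightarrow> Pos a \<in> set (body r) \<or> Neg a \<in> set (body r)" for a
    by (metis imageE image_eqI lit.exhaust lit_atm.simps)
  then show ?thesis by (auto simp: rule_atms_def pos_body_def neg_body_def)
qed

text \<open>A smaller model of the bottom part, completed by the rest of M, would be a smaller model of
  the whole reduct.\<close>

lemma stable_in_restrict:
  assumes M: "stable_in R M" and U: "closed_in R U"
  shows "stable_in (touching U R) (M \<inter> U)"
proof -
  have mod: "neg_body r \<inter> M = {} \<Longrightarrow> pos_body r \<subseteq> M \<Longrightarrow> set (head r) \<inter> M \<noteq> {}" if "r \<in> R" for r
    using M that by (auto simp: stable_in_def is_model_reduct_of)
  have atms: "set (head r) \<subseteq> U" "pos_body r \<subseteq> U" "neg_body r \<subseteq> U" if "r \<in> touching U R" for r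
    using U that by (auto simp: closed_in_def rule_atms_eq)
  have "is_model (reduct_of (touching U R) (M \<inter> U)) (M \<inter> U)"
    unfolding is_model_reduct_of
  proof (intro ballI impI)
    fix r assume r: "r \<in> touching U R" "neg_body r \<inter> (M \<inter> U) = {}" "pos_body r \<subseteq> M \<inter> U"
    then have "r \<in> R" "neg_body r \<inter> M = {}" "pos_body r \<subseteq> M"
      using atms[OF r(1)] by (auto simp: touching_def)
    then show "set (head r) \<inter> (M \<inter> U) \<noteq> {}" using mod[of r] atms[OF r(1)] by blast
  qed
  moreover have "\<not> is_model (reduct_of (touching U R) (M \<inter> U)) N" if N: "N \<subset> M \<inter> U" for N
  proof
    assume mN: "is_model (reduct_of (touching U R) (M \<inter> U)) N"
    have "is_model (reduct_of R M) (N \<union> (M - U))"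
      unfolding is_model_reduct_of
    proof (intro ballI impI)
      fix r assume r: "r \<in> R" "neg_body r \<inter> M = {}" "pos_body r \<subseteq> N \<union> (M - U)"
      show "set (head r) \<inter> (N \<union> (M - U)) \<noteq> {}"
      proof (cases "r \<in> touching U R")
        case True
        then have "pos_body r \<subseteq> N" using r atms by blast
        then show ?thesis using mN True r by (auto simp: is_model_reduct_of)
      next
        \<comment> \<open>A head disjoint from \<open>U\<close> is satisfied by \<open>M\<close>
          outside \<open>U\<close>, where no atom has been removed.\<close>
        case False
        then have "set (head r) \<inter> U = {}" using r(1) by (simp add: touching_def)
        moreover have "pos_body r \<subseteq> M" using r(3) N by blast
        ultimately show ?thesis using mod[OF r(1,2)] by blast
      qed
    qed
    moreover have "N \<union> (M - U) \<subset> M" using N by blast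
    ultimately show False using M by (auto simp: stable_in_def)
  qed
  ultimately show ?thesis by (auto simp: stable_in_def)
qed

text \<open>Both halves of stability are local. A violated rule has a head atom, so it already
  belongs to some bottom part; a smaller model misses an atom of \<open>M\<close>, and the part
  \<open>U k\<close> containing this atom sees a smaller model as well.\<close>

lemma stable_in_limit:
  fixes U :: "nat \<Rightarrow> atm set"
  assumes heads: "\<And>r. r \<in> R \<Longrightarrow> set (head r) \<noteq> {}"
    and closed: "\<And>k. closed_in R (U k)" and cover: "\<And>r. r \<in> R \<Longrightarrow> rule_atms r \<subseteq> (\<Union>k. U k)"
    and M: "M \<subseteq> (\<Union>k. U k)" "\<And>k. stable_in (touching (U k) R) (M \<inter> U k)"
  shows "stable_in R M"
proof -
  have atms: "set (head r) \<subseteq> U k" "pos_body r \<subseteq> U k" "neg_body r \<subseteq> U k" if "r \<in> touching (U k) R" for r k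
    using closed that by (auto simp: closed_in_def rule_atms_eq)
  have model: "neg_body r \<inter> (M \<inter> U k) = {} \<Longrightarrow> pos_body r \<subseteq> M \<inter> U k \<Longrightarrow> set (head r) \<inter> (M \<inter> U k) \<noteq> {}"
    if "r \<in> touching (U k) R" for r k
    using M(2)[of k] that unfolding stable_in_def is_model_reduct_of by blast
  have "is_model (reduct_of R M) M"
    unfolding is_model_reduct_of
  proof (intro ballI impI)
    fix r assume r: "r \<in> R" "neg_body r \<inter> M = {}" "pos_body r \<subseteq> M"
    obtain a where a: "a \<in> set (head r)" using heads[OF r(1)] by (meson all_not_in_conv)
    then have "a \<in> (\<Union>k. U k)" using cover[OF r(1)] by (auto simp: rule_atms_def)
    then obtain k where k: "r \<in> touching (U k) R" using a r(1) by (auto simp: touching_def)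
    have "neg_body r \<inter> (M \<inter> U k) = {}" "pos_body r \<subseteq> M \<inter> U k"
      using r(2,3) atms(2)[OF k] by auto
    from model[OF k this] show "set (head r) \<inter> M \<noteq> {}" by blast
  qed
  moreover have "\<not> is_model (reduct_of R M) N" if N: "N \<subset> M" for N
  proof
    assume mN: "is_model (reduct_of R M) N"
    obtain a k where a: "a \<in> M" "a \<notin> N" "a \<in> U k" using N M(1) by blast
    have "is_model (reduct_of (touching (U k) R) (M \<inter> U k)) (N \<inter> U k)"
      unfolding is_model_reduct_of
    proof (intro ballI impI)
      fix r assume r: "r \<in> touching (U k) R" "neg_body r \<inter> (M \<inter> U k) = {}" "pos_body r \<subseteq> N \<inter> U k"
      have "r \<in> R" "neg_body r \<inter> M = {}" "pos_body r \<subseteq> N"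
        using r atms(3)[OF r(1)] by (auto simp: touching_def)
      then have "set (head r) \<inter> N \<noteq> {}" using mN by (simp add: is_model_reduct_of)
      then show "set (head r) \<inter> (N \<inter> U k) \<noteq> {}" using atms(1)[OF r(1)] by blast
    qed
    moreover have "N \<inter> U k \<subset> M \<inter> U k" using N a by blast
    ultimately show False using M(2)[of k] by (auto simp: stable_in_def)
  qed
  ultimately show ?thesis by (auto simp: stable_in_def)
qed

text \<open>The tree has the members of \<open>S k\<close> as nodes at level k, with restriction as
  the parent map; it branches finitely because \<open>U k\<close> has finitely many subsets. The
  branch runs through \<open>good\<close> nodes, those with descendants at all later levels.\<close>

lemma koenig_sets:
  fixes U :: "nat \<Rightarrow> 'a set" and S :: "nat \<Rightarrow> 'a set set"
  assumes fin: "\<And>k. finite (U k)" and mono: "\<And>j k. j \<le> k \<Longrightarrow> U j \<subseteq> U k"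
    and ne: "\<And>k. S k \<noteq> {}" and sub: "\<And>k X. X \<in> S k \<Longrightarrow> X \<subseteq> U k"
    and restrict: "\<And>j k X. j \<le> k \<Longrightarrow> X \<in> S k \<Longrightarrow> X \<inter> U j \<in> S j"
  shows "\<exists>M \<subseteq> (\<Union>k. U k). \<forall>k. M \<inter> U k \<in> S k"
proof -
  define good where "good k X \<longleftrightarrow> (\<forall>j\<ge>k. \<exists>Y\<in>S j. Y \<inter> U k = X)" for k X
  \<comment> \<open>With \<open>A\<close> empty this gives the root of the branch, with
    \<open>A = U k\<close> at level k + 1 its continuation.\<close>
  have extend: "\<exists>X'. good k X' \<and> X' \<inter> A = X"
    if A: "A \<subseteq> U k" and ex: "\<And>j. j \<ge> k \<Longrightarrow> \<exists>Y\<in>S j. Y \<inter> A = X" for k A X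
  proof (rule ccontr)
    assume contra: "\<not> ?thesis"
    have "\<exists>j\<ge>k. \<forall>Y\<in>S j. Y \<inter> U k \<noteq> X'" if "X' \<inter> A = X" for X'
    proof -
      have "\<not> good k X'" using contra that by metis
      then show ?thesis unfolding good_def by metis
    qed
    then obtain J where J: "\<And>X'. X' \<inter> A = X \<Longrightarrow> J X' \<ge> k \<and> (\<forall>Y\<in>S (J X'). Y \<inter> U k \<noteq> X')" by metis
    \<comment> \<open>Were no candidate good, each would have died out by its level
      \<open>J\<close>. Level \<open>m\<close> lies beyond all of these, yet a member of
      \<open>S m\<close> restricts to a candidate that still has a descendant at its own level
      \<open>J\<close>.\<close>
    define m where "m = Max (insert k (J ` Pow (U k)))"
    have m: "k \<le> m" "\<And>X'. X' \<subseteq> U k \<Longrightarrow> J X' \<le> m"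
      unfolding m_def using fin by (auto intro!: Max_ge)
    obtain Y where Y: "Y \<in> S m" "Y \<inter> A = X" using ex[OF m(1)] by blast
    have "(Y \<inter> U k) \<inter> A = X" using Y A by blast
    note JY = J[OF this]
    have "Y \<inter> U (J (Y \<inter> U k)) \<in> S (J (Y \<inter> U k))" by (rule restrict[OF m(2) Y(1)]) simp
    moreover have "Y \<inter> U (J (Y \<inter> U k)) \<inter> U k = Y \<inter> U k" using mono[of k "J (Y \<inter> U k)"] JY by blast
    ultimately show False using JY by blast
  qed
  have "\<exists>f. \<forall>k. good k (f k) \<and> f (Suc k) \<inter> U k = f k"
  proof (rule dependent_nat_choice)
    show "\<exists>X. good 0 X" using extend[of "{}" 0 "{}"] ne by auto
    show "\<exists>X'. good (Suc k) X' \<and> X' \<inter> U k = X" if "good k X" for X k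
      using extend[of "U k" "Suc k" X] that mono unfolding good_def by simp
  qed
  then obtain f where f: "\<And>k. good k (f k)" "\<And>k. f (Suc k) \<inter> U k = f k" by blast
  have f_sub: "f k \<subseteq> U k" for k using f(1)[of k] unfolding good_def by blast
  have f_restrict: "f (k + d) \<inter> U k = f k" for k d
  proof (induction d)
    case 0
    then show ?case using f_sub by auto
  next
    case (Suc d)
    have "U k \<subseteq> U (k + d)" using mono by simp
    then have "f (k + Suc d) \<inter> U k = (f (Suc (k + d)) \<inter> U (k + d)) \<inter> U k" by auto
    then show ?case using f(2) Suc by simp
  qed
  have "(\<Union>j. f j) \<inter> U k = f k" for k
  proof
    show "(\<Union>j. f j) \<inter> U k \<subseteq> f k"
    proof
      fix a assume "a \<in> (\<Union>j. f j) \<inter> U k"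
      then obtain j where j: "a \<in> f j" "a \<in> U k" by blast
      show "a \<in> f k"
      proof (cases "k \<le> j")
        case True
        then show ?thesis using f_restrict[of k "j - k"] j by auto
      next
        case False
        then show ?thesis using f_restrict[of j "k - j"] j by auto
      qed
    qed
  qed (use f_sub in blast)
  moreover have "f k \<in> S k" for k
    using f(1)[of k] sub[of _ k] unfolding good_def by (metis inf.absorb1 order_refl)
  ultimately show ?thesis using f_sub by (intro exI[of _ "\<Union>j. f j"]) auto
qed

lemma holds_cong: "fm_atms F \<subseteq> U \<Longrightarrow> holds (M \<inter> U) F = holds M F"
  by (induction F) auto

definition refutable_on :: "program \<Rightarrow> fm \<Rightarrow> atm set \<Rightarrow> bool" where
  "refutable_on P F U \<longleftrightarrow> (\<exists>X \<subseteq> U. stable_in (touching U (Ground P)) X \<and> \<not> holds X F)"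

lemma touching_touching: "U \<subseteq> V \<Longrightarrow> touching U (touching V R) = touching U R"
  by (auto simp: touching_def)

lemma closed_in_touching: "closed_in R U \<Longrightarrow> closed_in (touching V R) U"
  by (auto simp: closed_in_def touching_def)

lemma skeptical_consequence_iff:
  assumes P: "wf_program P" "finitely_recursive P" and F: "ground_formula P F"
  shows "skeptical_consequence P F \<longleftrightarrow>
    (\<exists>U. finite U \<and> U \<subseteq> HB P \<and> fm_atms F \<subseteq> U \<and> closed_in (Ground P) U \<and> \<not> refutable_on P F U)"
    (is "?L \<longleftrightarrow> ?R")
proof
  assume ?R
  then obtain U where U: "fm_atms F \<subseteq> U" "closed_in (Ground P) U" "\<not> refutable_on P F U" by blast
  show ?L unfolding skeptical_consequence_def
  proof (intro allI impI)
    fix M assume "stable_model P M"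
    then have "stable_in (touching U (Ground P)) (M \<inter> U)"
      using U(2) by (auto simp: stable_model_iff intro: stable_in_restrict)
    then have "holds (M \<inter> U) F" using U(3) by (auto simp: refutable_on_def)
    then show "holds M F" using U(1) by (simp add: holds_cong)
  qed
next
  assume L: ?L
  show ?R
  proof (rule ccontr)
    assume "\<not> ?R"
    then have refutable: "refutable_on P F U"
      if "finite U" "U \<subseteq> HB P" "fm_atms F \<subseteq> U" "closed_in (Ground P) U" for U
      using that by blast
    \<comment> \<open>Cutting off by code exhausts the Herbrand base with finite sets; the atoms of
      \<open>F\<close> are included from the start, so that every level can decide
      \<open>F\<close>.\<close>
    define B where "B k = fm_atms F \<union> {a \<in> HB P. enc_atm a < k}" for k
    define U where "U k = (dep P)\<^sup>* `` B k" for k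
    have fm: "finite (fm_atms F)" by (induction F) auto
    have "finite {a \<in> HB P. enc_atm a < k}" for k
      using finite_vimageI[OF finite_lessThan[of k], of enc_atm]
      by (rule rev_finite_subset[OF _ subsetI]) (auto simp: inj_on_def enc_atm_inject)
    then have B: "finite (B k)" "B k \<subseteq> HB P" for k
      using F fm by (auto simp: B_def ground_formula_def)
    have "U k = (\<Union>a\<in>B k. {b. (a, b) \<in> (dep P)\<^sup>*})" for k
      by (auto simp: U_def)
    then have fin: "finite (U k)" for k
      using B P(2) subsetD[OF B(2)] by (auto simp: finitely_recursive_def)
    have "(a, b) \<in> (dep P)\<^sup>* \<Longrightarrow> a \<in> HB P \<Longrightarrow> b \<in> HB P" for a b
      by (induction rule: rtrancl_induct) (use Ground_atms_HB in \<open>auto simp: dep_def\<close>)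
    then have HB: "U k \<subseteq> HB P" for k using subsetD[OF B(2)] by (auto simp: U_def)
    have BU: "B k \<subseteq> U k" for k by (auto simp: U_def)
    have mono: "U j \<subseteq> U k" if "j \<le> k" for j k
      using that by (auto simp: U_def B_def)
    have "rule_atms r \<subseteq> U k" if r: "r \<in> touching (U k) (Ground P)" for r k
    proof
      fix b assume b: "b \<in> rule_atms r"
      obtain a c where a: "a \<in> set (head r)" "c \<in> B k" "(c, a) \<in> (dep P)\<^sup>*"
        using r by (auto simp: touching_def U_def)
      \<comment> \<open>Here it matters that dependency has edges from a head atom to the other head
        atoms: one atom of the head reaches the entire rule.\<close>
      have "(a, b) \<in> dep P" using r a b by (auto simp: dep_def touching_def)
      then show "b \<in> U k" using a by (auto simp: U_def intro: rtrancl_into_rtrancl)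
    qed
    then have closed: "closed_in (Ground P) (U k)" for k by (auto simp: closed_in_def)
    have FU: "fm_atms F \<subseteq> U k" for k using BU by (auto simp: B_def)
    have HBU: "HB P \<subseteq> (\<Union>k. U k)"
    proof
      fix a assume "a \<in> HB P"
      then have "a \<in> B (Suc (enc_atm a))" by (simp add: B_def)
      then show "a \<in> (\<Union>k. U k)" using BU by blast
    qed
    define S where "S k = {X. X \<subseteq> U k \<and> stable_in (touching (U k) (Ground P)) X \<and> \<not> holds X F}" for k
    have "\<exists>M \<subseteq> (\<Union>k. U k). \<forall>k. M \<inter> U k \<in> S k"
    proof (rule koenig_sets)
      show "S k \<noteq> {}" for k
        using refutable[OF fin HB FU closed] by (auto simp: S_def refutable_on_def)
      \<comment> \<open>The splitting argument is applied inside the bottom part of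
        \<open>U k\<close>, whose own bottom part for \<open>U j\<close> is that of the whole
        program.\<close>
      show "X \<inter> U j \<in> S j" if "j \<le> k" "X \<in> S k" for j k X
        using stable_in_restrict[OF _ closed_in_touching[OF closed[of j]], of "U k" X] that(2)
        by (auto simp: S_def touching_touching mono[OF that(1)] holds_cong FU)
    qed (use fin mono in \<open>auto simp: S_def\<close>)
    then obtain M where M: "M \<subseteq> (\<Union>k. U k)" "\<And>k. M \<inter> U k \<in> S k" by blast
    have "stable_in (Ground P) M"
    proof (rule stable_in_limit)
      show "set (head r) \<noteq> {}" if "r \<in> Ground P" for r
      proof -
        have "head (subst_rule \<sigma> r) = [] \<longleftrightarrow> head r = []" for \<sigma> r by (cases r) simp
        then show ?thesis using that P(1) by (auto simp: Ground_def wf_program_def)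
      qed
      show "rule_atms r \<subseteq> (\<Union>k. U k)" if "r \<in> Ground P" for r
        using Ground_atms_HB[OF that] HBU by blast
    qed (use M closed in \<open>auto simp: S_def\<close>)
    moreover have "M \<subseteq> HB P" using M(1) HB by blast
    ultimately have "holds M F" using L by (auto simp: skeptical_consequence_def stable_model_iff)
    moreover have "\<not> holds (M \<inter> U 0) F" using M(2)[of 0] by (simp add: S_def)
    ultimately show False by (simp add: holds_cong[OF FU])
  qed
qed

section \<open>Testing one depth is primitive recursive\<close>

lemma pr_head [pr_intros]: "pr f \<Longrightarrow> pr (\<lambda>x. head (f x))"
proof (rule pr_comp[of head], rule prI[OF prec1_fst_decode])
  show "gnum (head r) = fst (prod_decode (gnum r))" for r
    by (cases r) (simp add: gnum_rule_def gnum_list_def gnum_atm_def)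
qed

lemma pr_body [pr_intros]: "pr f \<Longrightarrow> pr (\<lambda>x. body (f x))"
proof (rule pr_comp[of body], rule prI[OF prec1_snd_decode])
  show "gnum (body r) = snd (prod_decode (gnum r))" for r
    by (cases r) (simp add: gnum_rule_def gnum_list_def gnum_lit_def)
qed

lemma pr_args [pr_intros]: "pr f \<Longrightarrow> pr (\<lambda>x. args (f x))"
proof (rule pr_comp[of args], rule prI[OF prec1_snd_decode])
  show "gnum (args a) = snd (prod_decode (gnum a))" for a
    by (cases a) (simp add: gnum_atm_def gnum_list_def gnum_trm_def)
qed

text \<open>The code of an atom stores no arity, so it is recovered as the length of the argument
  list.\<close>

lemma pr_psym [pr_intros]:
  assumes "pr f"
  shows "pr (\<lambda>x. psym (f x))"
proof -
  have "pr (\<lambda>a. fst (psym a))"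
  proof (rule prI[OF prec1_fst_decode])
    show "gnum (fst (psym a)) = fst (prod_decode (gnum a))" for a
      by (cases a) (simp add: gnum_atm_def gnum_nat_def)
  qed
  then have "pr (\<lambda>x. (fst (psym (f x)), length (args (f x))))"
    by (intro pr_Pair pr_length pr_args pr_comp[OF \<open>pr (\<lambda>a. fst (psym a))\<close>] assms)
  moreover have "(fst (psym a), length (args a)) = psym a" for a by (cases a) simp
  ultimately show ?thesis by simp
qed

lemma pr_Rule [pr_intros]:
  assumes "pr f" "pr g"
  shows "pr (\<lambda>x. Rule (f x) (g x))"
proof -
  have "pr (\<lambda>p. Rule (fst p) (snd p))"
    by (rule prI[OF prec1_id])
      (simp add: gnum_rule_def gnum_prod_def gnum_list_def gnum_lit_def gnum_atm_def)
  from pr_comp[OF this pr_Pair[OF assms]] show ?thesis by simp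
qed

lemma pr_Atom [pr_intros]:
  assumes "pr f" "pr g"
  shows "pr (\<lambda>x. Atom (f x) (g x))"
proof -
  have "pr (\<lambda>p. Atom (fst p) (snd p))"
    by (rule prI[OF prec1_id])
      (simp add: gnum_prod_def gnum_list_def gnum_trm_def gnum_atm_def gnum_nat_def)
  from pr_comp[OF this pr_Pair[OF assms]] show ?thesis by simp
qed

lemma pr_Fn [pr_intros]:
  assumes "pr f" "pr g"
  shows "pr (\<lambda>x. Fn (f x) (g x))"
proof -
  have "pr (\<lambda>p. Fn (fst p) (snd p))"
  proof (rule prI_nat)
    show "pr (\<lambda>n::nat. Suc (n + n))" by (intro pr_intros)
  qed (simp add: gnum_prod_def gnum_list_def gnum_trm_def gnum_nat_def sum_encode_def)
  from pr_comp[OF this pr_Pair[OF assms]] show ?thesis by simp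
qed

lemma pr_Pos [pr_intros]: "pr f \<Longrightarrow> pr (\<lambda>x. Pos (f x))"
proof (rule pr_comp[of Pos], rule prI_nat)
  show "pr (\<lambda>n::nat. n + n)" by (intro pr_intros)
qed (simp add: gnum_lit_def gnum_atm_def sum_encode_def)

lemma pr_Neg [pr_intros]: "pr f \<Longrightarrow> pr (\<lambda>x. Neg (f x))"
proof (rule pr_comp[of Neg], rule prI_nat)
  show "pr (\<lambda>n::nat. Suc (n + n))" by (intro pr_intros)
qed (simp add: gnum_lit_def gnum_atm_def sum_encode_def)

lemma pr_case_lit [pr_intros]:
  assumes "pr l" "pr (\<lambda>z. a (fst z) (snd z))" "pr (\<lambda>z. b (fst z) (snd z))"
  shows "pr (\<lambda>x. case l x of Pos A \<Rightarrow> a x A | Neg A \<Rightarrow> b x A)"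
proof -
  obtain l' where l': "pr l'" "\<And>x. gnum (l x) = l' (gnum x)" using assms(1) by (rule prE_nat) blast
  obtain a' where a': "pr a'" "\<And>z. gnum (a (fst z) (snd z)) = a' (gnum z)"
    using assms(2) by (rule prE_nat) blast
  obtain b' where b': "pr b'" "\<And>z. gnum (b (fst z) (snd z)) = b' (gnum z)"
    using assms(3) by (rule prE_nat) blast
  show ?thesis
  proof (rule prI_nat)
    show "pr (\<lambda>x. if even (l' x) then a' (prod_encode (x, l' x div 2)) else b' (prod_encode (x, l' x div 2)))"
      by (intro pr_nat_intros l' pr_comp[OF a'(1)] pr_comp[OF b'(1)])
    show "gnum (case l x of Pos A \<Rightarrow> a x A | Neg A \<Rightarrow> b x A) =
      (if even (l' (gnum x)) then a' (prod_encode (gnum x, l' (gnum x) div 2))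
       else b' (prod_encode (gnum x, l' (gnum x) div 2)))" for x
      using a'(2)[of "(x, A)" for A] b'(2)[of "(x, A)" for A]
      by (cases "l x") (simp_all add: gnum_lit_def gnum_atm_def gnum_Pair sum_encode_def flip: l'(2))
  qed
qed

lemma pr_lit_atm [pr_intros]: "pr f \<Longrightarrow> pr (\<lambda>x. lit_atm (f x))"
proof -
  assume "pr f"
  then have "pr (\<lambda>x. case f x of Pos A \<Rightarrow> A | Neg A \<Rightarrow> A)" by (intro pr_intros)
  moreover have "(case l of Pos A \<Rightarrow> A | Neg A \<Rightarrow> A) = lit_atm l" for l by (cases l) auto
  ultimately show ?thesis by simp
qed

text \<open>The recursion has no parameter; a dummy 0 fills the environment slot of
  \<open>pr_rec_trm\<close>.\<close>

lemma pr_trm_fsyms [pr_intros]: "pr t \<Longrightarrow> pr (\<lambda>x. trm_fsyms (t x))"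
proof (rule pr_rec_trm[where T = "\<lambda>_. trm_fsyms" and e = "\<lambda>_. 0 :: nat"])
  show "trm_fsyms (Var v) = (\<lambda>_ _. []) (0::nat) v" for v by simp
  show "trm_fsyms (Fn f ts) = (\<lambda>_ f ts rs. (f, length ts) # concat rs) (0::nat) f ts (map trm_fsyms ts)" for f ts
    by simp
qed (intro pr_intros; assumption?)+

lemma pr_var_bound [pr_intros]: "pr t \<Longrightarrow> pr (\<lambda>x. var_bound (t x))"
proof (rule pr_rec_trm[where T = "\<lambda>_. var_bound" and e = "\<lambda>_. 0 :: nat"])
  show "var_bound (Var v) = (\<lambda>_ v. Suc v) (0::nat) v" for v by simp
  show "var_bound (Fn f ts) = (\<lambda>_ f ts rs. sum_list rs) (0::nat) f ts (map var_bound ts)" for f ts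
    by simp
qed (intro pr_intros; assumption?)+

text \<open>A substitution is an infinite object without a code. The list representing it is passed
  as the environment of the recursion.\<close>

lemma pr_subst_trm [pr_intros]: "pr s \<Longrightarrow> pr t \<Longrightarrow> pr (\<lambda>x. subst_trm (list_subst (s x)) (t x))"
proof (rule pr_rec_trm[where T = "\<lambda>s. subst_trm (list_subst s)"])
  show "subst_trm (list_subst s) (Var v) = (\<lambda>s v. hd (drop v s)) s v" for s v by (simp add: list_subst_def)
  show "subst_trm (list_subst s) (Fn f ts) = (\<lambda>s f ts rs. Fn f rs) s f ts (map (subst_trm (list_subst s)) ts)" for s f ts
    by simp
qed (intro pr_intros; assumption?)+

lemma pr_subst_atm [pr_intros]:
  assumes "pr s" "pr a"
  shows "pr (\<lambda>x. subst_atm (list_subst (s x)) (a x))"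
proof -
  have "Atom (fst (psym a)) (map (\<lambda>t. subst_trm \<sigma> t) (args a)) = subst_atm \<sigma> a" for a \<sigma> by (cases a) simp
  moreover have "pr (\<lambda>x. Atom (fst (psym (a x))) (map (\<lambda>t. subst_trm (list_subst (s x)) t) (args (a x))))"
    by (intro pr_intros assms pr_comp[OF assms(1)])
  ultimately show ?thesis by simp
qed

lemma pr_subst_lit [pr_intros]:
  assumes "pr s" "pr l"
  shows "pr (\<lambda>x. subst_lit (list_subst (s x)) (l x))"
proof -
  have "(case l of Pos A \<Rightarrow> Pos (subst_atm \<sigma> A) | Neg A \<Rightarrow> Neg (subst_atm \<sigma> A)) = subst_lit \<sigma> l" for l \<sigma>
    by (cases l) simp_all
  moreover have "pr (\<lambda>x. case l x of Pos A \<Rightarrow> Pos (subst_atm (list_subst (s x)) A)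
    | Neg A \<Rightarrow> Neg (subst_atm (list_subst (s x)) A))"
    by (intro pr_intros assms pr_comp[OF assms(1)])
  ultimately show ?thesis by simp
qed

lemma pr_subst_rule [pr_intros]:
  assumes "pr s" "pr r"
  shows "pr (\<lambda>x. subst_rule (list_subst (s x)) (r x))"
proof -
  have "Rule (map (\<lambda>a. subst_atm \<sigma> a) (head r)) (map (\<lambda>l. subst_lit \<sigma> l) (body r)) = subst_rule \<sigma> r" for r \<sigma>
    by (cases r) simp
  moreover have "pr (\<lambda>x. Rule (map (\<lambda>a. subst_atm (list_subst (s x)) a) (head (r x)))
    (map (\<lambda>l. subst_lit (list_subst (s x)) l) (body (r x))))"
    by (intro pr_intros assms pr_comp[OF assms(1)])
  ultimately show ?thesis by simp
qed

lemma pr_rule_atm_list [pr_intros]: "pr r \<Longrightarrow> pr (\<lambda>x. rule_atm_list (r x))"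
  unfolding rule_atm_list_def by (intro pr_intros)

lemma pr_prog_atm_list [pr_intros]: "pr P \<Longrightarrow> pr (\<lambda>x. prog_atm_list (P x))"
  unfolding prog_atm_list_def by (intro pr_intros)

lemma pr_prog_args [pr_intros]: "pr P \<Longrightarrow> pr (\<lambda>x. prog_args (P x))"
  unfolding prog_args_def by (intro pr_intros)

lemma pr_fsym_list [pr_intros]: "pr P \<Longrightarrow> pr (\<lambda>x. fsym_list (P x))"
  unfolding fsym_list_def by (intro pr_intros)

lemma pr_prog_var_bound [pr_intros]: "pr P \<Longrightarrow> pr (\<lambda>x. prog_var_bound (P x))"
  unfolding prog_var_bound_def by (intro pr_intros)

lemma pr_terms_upto [pr_intros]:
  assumes "pr P" "pr n"
  shows "pr (\<lambda>x. terms_upto (P x) (n x))"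
proof -
  have "rec_nat [] (\<lambda>_ acc. concat (map (\<lambda>c. map (\<lambda>ts. Fn (fst c) ts) (List.n_lists (snd c) acc)) (fsym_list P))) n
    = terms_upto P n" for P n by (induction n) auto
  moreover have "pr (\<lambda>x. rec_nat [] (\<lambda>_ acc.
    concat (map (\<lambda>c. map (\<lambda>ts. Fn (fst c) ts) (List.n_lists (snd c) acc)) (fsym_list (P x)))) (n x))"
    by (intro pr_intros assms pr_comp[OF assms(1)])
  ultimately show ?thesis by simp
qed

lemma pr_atoms_upto [pr_intros]:
  assumes "pr P" "pr n"
  shows "pr (\<lambda>x. atoms_upto (P x) (n x))"
  unfolding atoms_upto_def by (intro pr_intros pr_comp[OF assms(1)] pr_comp[OF assms(2)])

lemma pr_instances_upto [pr_intros]: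
  assumes "pr P" "pr n"
  shows "pr (\<lambda>x. instances_upto (P x) (n x))"
  unfolding instances_upto_def by (intro pr_intros pr_comp[OF assms(1)] pr_comp[OF assms(2)])

primrec fm_atm_list :: "fm \<Rightarrow> atm list" where
  "fm_atm_list (FAtom a) = [a]"
| "fm_atm_list (FNot F) = fm_atm_list F"
| "fm_atm_list (FAnd F G) = fm_atm_list F @ fm_atm_list G"
| "fm_atm_list (FOr F G) = fm_atm_list F @ fm_atm_list G"
| "fm_atm_list (FImp F G) = fm_atm_list F @ fm_atm_list G"

lemma set_fm_atm_list [simp]: "set (fm_atm_list F) = fm_atms F"
  by (induction F) auto

lemma pr_fm_atm_list [pr_intros]: "pr F \<Longrightarrow> pr (\<lambda>x. fm_atm_list (F x))"
  by (rule pr_rec_fm[where T = "\<lambda>_. fm_atm_list" and e = "\<lambda>_. 0 :: nat" and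
        a = "\<lambda>_ A. [A]" and b = "\<lambda>_ u. u" and c = "\<lambda>_ _ u v. u @ v"])
    (simp_all add: pr_intros)

lemma pr_holds [pr_intros]: "pr X \<Longrightarrow> pr F \<Longrightarrow> pr (\<lambda>x. holds (set (X x)) (F x))"
  by (rule pr_rec_fm[where T = "\<lambda>X. holds (set X)" and
        a = "\<lambda>X A. A \<in> set X" and b = "\<lambda>_ u. \<not> u" and
        c = "\<lambda>_ k u v. if k = 2 then u \<and> v else if k = 3 then u \<or> v else u \<longrightarrow> v"])
    (simp, simp, simp, simp, simp, (intro pr_intros; assumption?)+)

section \<open>The test at one depth and its correctness\<close>

definition touches :: "atm list \<Rightarrow> rule \<Rightarrow> bool" where
  "touches U g \<longleftrightarrow> (\<exists>a\<in>set (head g). a \<in> set U)"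

text \<open>Negative literals are evaluated in \<open>X\<close> and everything else in
  \<open>Y\<close>, which amounts to \<open>Y\<close> satisfying what the reduct by \<open>X\<close>
  retains of the rule; the reduct is never built.\<close>

definition satisfies :: "atm list \<Rightarrow> atm list \<Rightarrow> rule \<Rightarrow> bool" where
  "satisfies X Y g \<longleftrightarrow>
     (\<forall>l\<in>set (body g). case l of Pos a \<Rightarrow> a \<in> set Y | Neg a \<Rightarrow> a \<notin> set X) \<longrightarrow> (\<exists>a\<in>set (head g). a \<in> set Y)"

text \<open>Subsequences enumerate all subsets of \<open>X\<close>. Minimality asks that each of
  them that is a model contain \<open>X\<close>, which avoids proper inclusion of lists.\<close>

definition stable_list :: "rule list \<Rightarrow> atm list \<Rightarrow> atm list \<Rightarrow> bool" where
  "stable_list G U X \<longleftrightarrow> (\<forall>g\<in>set G. touches U g \<longrightarrow> satisfies X X g) \<and>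
     (\<forall>Y\<in>set (subseqs X). (\<forall>g\<in>set G. touches U g \<longrightarrow> satisfies X Y g) \<longrightarrow> (\<forall>a\<in>set X. a \<in> set Y))"

definition certificate :: "fm \<Rightarrow> rule list \<Rightarrow> atm list \<Rightarrow> bool" where
  "certificate F G U \<longleftrightarrow> (\<forall>a\<in>set (fm_atm_list F). a \<in> set U) \<and>
     (\<forall>g\<in>set G. touches U g \<longrightarrow> (\<forall>a\<in>set (rule_atm_list g). a \<in> set U)) \<and>
     (\<forall>X\<in>set (subseqs U). stable_list G U X \<longrightarrow> holds (set X) F)"

definition check :: "program \<Rightarrow> fm \<Rightarrow> nat \<Rightarrow> bool" where
  "check P F n \<longleftrightarrow> (\<exists>U\<in>set (subseqs (atoms_upto P n)). certificate F (instances_upto P (Suc n)) U)"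

lemma pr_touches [pr_intros]:
  assumes "pr U" "pr g"
  shows "pr (\<lambda>x. touches (U x) (g x))"
  unfolding touches_def by (intro pr_intros pr_comp[OF assms(1)] assms)

lemma pr_satisfies [pr_intros]:
  assumes "pr X" "pr Y" "pr g"
  shows "pr (\<lambda>x. satisfies (X x) (Y x) (g x))"
  unfolding satisfies_def by (intro pr_intros pr_comp[OF assms(1)] pr_comp[OF assms(2)] assms)

lemma pr_stable_list [pr_intros]:
  assumes "pr G" "pr U" "pr X"
  shows "pr (\<lambda>x. stable_list (G x) (U x) (X x))"
  unfolding stable_list_def
  by (intro pr_intros pr_comp[OF assms(1)] pr_comp[OF assms(2)] pr_comp[OF assms(3)])

lemma pr_certificate [pr_intros]:
  assumes "pr F" "pr G" "pr U"
  shows "pr (\<lambda>x. certificate (F x) (G x) (U x))"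
  unfolding certificate_def
  by (intro pr_intros pr_comp[OF assms(1)] pr_comp[OF assms(2)] pr_comp[OF assms(3)])

lemma pr_check: "pr (\<lambda>z. check (fst (fst z)) (snd (fst z)) (snd z))"
  unfolding check_def by (intro pr_intros)

lemma ball_subseqs: "(\<forall>Y\<in>set (subseqs xs). Q (set Y)) \<longleftrightarrow> (\<forall>Y\<subseteq>set xs. Q Y)"
  using subseqs_powset[of xs] by (metis (no_types, lifting) PowD PowI image_eqI imageE)

lemma bex_subseqs: "(\<exists>Y\<in>set (subseqs xs). Q (set Y)) \<longleftrightarrow> (\<exists>Y\<subseteq>set xs. Q Y)"
  using ball_subseqs[of xs "\<lambda>Y. \<not> Q Y"] by blast

lemma satisfies_iff:
  "satisfies X Y g \<longleftrightarrow>
    (neg_body g \<inter> set X = {} \<longrightarrow> pos_body g \<subseteq> set Y \<longrightarrow> set (head g) \<inter> set Y \<noteq> {})"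
proof -
  have "(\<forall>l\<in>set (body g). case l of Pos a \<Rightarrow> a \<in> set Y | Neg a \<Rightarrow> a \<notin> set X) \<longleftrightarrow>
    neg_body g \<inter> set X = {} \<and> pos_body g \<subseteq> set Y"
    by (auto simp: neg_body_def pos_body_def split: lit.splits)
  then show ?thesis by (auto simp: satisfies_def)
qed

lemma stable_list_iff: "stable_list G U X \<longleftrightarrow> stable_in (touching (set U) (set G)) (set X)"
proof -
  have model: "(\<forall>g\<in>set G. touches U g \<longrightarrow> satisfies X Y g) \<longleftrightarrow>
    is_model (reduct_of (touching (set U) (set G)) (set X)) (set Y)" for Y
    by (auto simp: is_model_reduct_of satisfies_iff touches_def touching_def)
  have "stable_list G U X \<longleftrightarrow> is_model (reduct_of (touching (set U) (set G)) (set X)) (set X) \<and>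
    (\<forall>N\<subseteq>set X. is_model (reduct_of (touching (set U) (set G)) (set X)) N \<longrightarrow> set X \<subseteq> N)"
    unfolding stable_list_def model subset_eq[symmetric]
    using ball_subseqs[of X "\<lambda>N. is_model (reduct_of (touching (set U) (set G)) (set X)) N \<longrightarrow> set X \<subseteq> N"]
    by blast
  then show ?thesis unfolding stable_in_def by blast
qed

lemma certificate_iff: "certificate F G U \<longleftrightarrow> fm_atms F \<subseteq> set U \<and> closed_in (set G) (set U) \<and>
  (\<forall>X\<subseteq>set U. stable_in (touching (set U) (set G)) X \<longrightarrow> holds X F)"
proof -
  have closed: "(\<forall>g\<in>set G. touches U g \<longrightarrow> set (rule_atm_list g) \<subseteq> set U) \<longleftrightarrow> closed_in (set G) (set U)"
    by (auto simp: closed_in_def touching_def touches_def)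
  show ?thesis
    using ball_subseqs[of U "\<lambda>X. stable_in (touching (set U) (set G)) X \<longrightarrow> holds X F"]
    unfolding certificate_def closed stable_list_iff set_fm_atm_list subset_eq[symmetric] by (simp only:)
qed

text \<open>Passing the closedness test on finitely many instances certifies that none of the
  remaining instances touches \<open>U\<close>, so stability is tested on the true bottom
  part.\<close>

lemma touching_instances_upto:
  assumes "U \<subseteq> set (atoms_upto P n)" "closed_in (set (instances_upto P (Suc n))) U"
  shows "touching U (set (instances_upto P (Suc n))) = touching U (Ground P)"
proof
  show "touching U (set (instances_upto P (Suc n))) \<subseteq> touching U (Ground P)"
    using instances_upto_Ground by (auto simp: touching_def)
  show "touching U (Ground P) \<subseteq> touching U (set (instances_upto P (Suc n)))"
    using Ground_touching_instances_upto[OF assms(1)] assms(2)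
    by (fastforce simp: touching_def closed_in_def)
qed

lemma check_iff: "check P F n \<longleftrightarrow> (\<exists>U \<subseteq> set (atoms_upto P n).
  fm_atms F \<subseteq> U \<and> closed_in (Ground P) U \<and> \<not> refutable_on P F U)"
proof -
  let ?G = "set (instances_upto P (Suc n))"
  have equiv: "closed_in ?G U \<and> (\<forall>X\<subseteq>U. stable_in (touching U ?G) X \<longrightarrow> holds X F) \<longleftrightarrow>
    closed_in (Ground P) U \<and> \<not> refutable_on P F U" if U: "U \<subseteq> set (atoms_upto P n)" for U
  proof -
    have "closed_in (Ground P) U \<Longrightarrow> closed_in ?G U"
      using instances_upto_Ground by (auto simp: closed_in_def touching_def)
    moreover have "touching U ?G = touching U (Ground P)" "closed_in (Ground P) U" if closed: "closed_in ?G U"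
    proof -
      show eq: "touching U ?G = touching U (Ground P)" by (rule touching_instances_upto[OF U closed])
      show "closed_in (Ground P) U" using closed unfolding closed_in_def eq .
    qed
    ultimately show ?thesis unfolding refutable_on_def by metis
  qed
  have "check P F n \<longleftrightarrow> (\<exists>U\<subseteq>set (atoms_upto P n). fm_atms F \<subseteq> U \<and> closed_in ?G U \<and>
    (\<forall>X\<subseteq>U. stable_in (touching U ?G) X \<longrightarrow> holds X F))"
    unfolding check_def certificate_iff
    by (rule bex_subseqs[where Q = "\<lambda>U. fm_atms F \<subseteq> U \<and> closed_in ?G U \<and>
      (\<forall>X\<subseteq>U. stable_in (touching U ?G) X \<longrightarrow> holds X F)"])
  then show ?thesis using equiv by metis
qed

lemma skeptical_consequence_iff_check:
  assumes "wf_program P" "finitely_recursive P" "ground_formula P F"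
  shows "skeptical_consequence P F \<longleftrightarrow> (\<exists>n. check P F n)"
proof
  assume "skeptical_consequence P F"
  then obtain U where U: "finite U" "U \<subseteq> HB P" "fm_atms F \<subseteq> U" "closed_in (Ground P) U" "\<not> refutable_on P F U"
    unfolding skeptical_consequence_iff[OF assms] by blast
  then obtain n where "U \<subseteq> set (atoms_upto P n)" using finite_subset_atoms_upto by blast
  then show "\<exists>n. check P F n" unfolding check_iff using U by blast
next
  assume "\<exists>n. check P F n"
  then obtain n U where U: "U \<subseteq> set (atoms_upto P n)" "fm_atms F \<subseteq> U" "closed_in (Ground P) U"
    "\<not> refutable_on P F U"
    unfolding check_iff by blast
  then have "finite U" "U \<subseteq> HB P" using atoms_upto_HB by (blast intro: finite_subset)+
  then show "skeptical_consequence P F" unfolding skeptical_consequence_iff[OF assms] using U by blast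
qed

theorem theorem5p3:
  shows "semidecidable_on
           {enc_input P F | P F. wf_program P \<and> finitely_recursive P \<and> ground_formula P F}
           {enc_input P F | P F. wf_program P \<and> finitely_recursive P \<and> ground_formula P F
                                 \<and> skeptical_consequence P F}"
proof -
  \<comment> \<open>Success is reported as 0, the accepting value in
    \<open>semidecidable_on\<close>.\<close>
  have "pr (\<lambda>z. if check (fst (fst z)) (snd (fst z)) (snd z) then 0 else 1 :: nat)"
    by (intro pr_intros pr_check)
  then obtain g where g: "pr g" and check:
    "\<And>z. gnum (if check (fst (fst z)) (snd (fst z)) (snd z) then 0 else 1 :: nat) = g (gnum z)"
    by (rule prE_nat) blast
  have "prn 2 (\<lambda>xs. g (prod_encode (xs ! 0, xs ! 1)))"
    by (intro prn1[OF g[unfolded pr_prec1]] prn2[OF prec2_prod_encode] prn_proj) auto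
  then obtain f where f: "prim_rec 2 f" "\<And>xs. length xs = 2 \<Longrightarrow> f xs = g (prod_encode (xs ! 0, xs ! 1))"
    unfolding prn_def by blast
  have fg: "f [enc_input P F, n] = 0 \<longleftrightarrow> check P F n" for P F n
    using check[of "((P, F), n)"] f(2)[of "[enc_input P F, n]"]
    by (simp add: gnum_Pair[of "(P, F)"] gnum_program_fm gnum_nat_def split: if_splits)
  \<comment> \<open>The sets contain codes, so membership of a code determines the program and
    formula only by injectivity.\<close>
  have inj: "enc_input P F = enc_input P' F' \<longleftrightarrow> P = P' \<and> F = F'" for P F P' F'
    unfolding gnum_program_fm[symmetric] by (simp add: gnum_inject)
  show ?thesis unfolding semidecidable_on_def
    by (rule exI[of _ f]) (auto simp: f(1) inj fg skeptical_consequence_iff_check)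
qed

end
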